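(* (i) Let $\alpha,\beta>0$ with $\alpha\ge 1+1/\beta$, and let $A=\{t_n\}_{n\ge1}$ with $t_n=\lfloor n^\alpha\rfloor$. Then there is a rank one system $(X,\mathcal{B},\mu,T)$ with sequence of tower heights $h_n$ such that $h^A(T)>0$ and $$\limsup_{n\to\infty}\frac{\log h_{n+1}}{h_n^{\beta}}<\infty.$$ (ii) Let $\alpha,\beta>0$ with $\alpha\ge 1/\beta$, and let $A=\{t_n\}_{n\ge1}$ with $t_n=\lfloor n(\log n)^\alpha\rfloor$. Then there is a rank one system $(X,\mathcal{B},\mu,T)$ with sequence of tower heights $h_n$ such that $h^A(T)>0$ and $$\limsup_{n\to\infty}\frac{\log h_{n+1}}{e^{h_n^{\beta}}}<\infty.$$
   Context: **Systems.** A measure-preserving system $(X,\mathcal{B},\mu,T)$ consists of a standard probability space and an invertible measure-preserving transformation $T$. Set equalities are modulo null sets. **Sequence entropy.** Let $f(0)=0$ and $f(x)=-x\log x$ for $x>0$. For a finite measurable partition $\xi=\{X_1,\dots,X_m\}$ put $H(\xi)=\sum_{i=1}^m f(\mu(X_i))$. For a sequence $A=\{t_n\}_{n\ge1}$ of non-negative integers put $$h^A(T,\xi)=\limsup_{n\to\infty}\frac1n H\Big(\bigvee_{k=1}^n T^{-t_k}\xi\Big),\qquad h^A(T)=\sup_\xi h^A(T,\xi),$$ the supremum being over all finite measurable partitions $\xi$ of $X$. (The sequence in (ii) is strictly increasing from some index on; the same formula is used.) **Rank one systems.** $(X,\mathcal{B},\mu,T)$ is a rank one system with sequence of tower heights $h_n$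 if there are integers $h_1\ge1$, $q_n\ge1$ ($n\ge1$) and $a_{n,i}\ge0$ ($n\ge1$, $1\le i\le q_n-1$) such that, with $a_n=\sum_{i=1}^{q_n-1}a_{n,i}$ and $h_{n+1}=q_nh_n+a_n$, the sequence $h_n$ is strictly increasing and $\sum_{n}a_n/h_{n+1}<\infty$, and measurable sets $F_n$ of positive measure such that for all $n\ge 1$: (a) $F_n,TF_n,\dots,T^{h_n-1}F_n$ are pairwise disjoint; their union is the tower $S_n$ with base $F_n$ and height $h_n$; (b) $F_n$ is partitioned into measurable sets $F_{n,1},\dots,F_{n,q_n}$; (c) $T^{h_n+a_{n,i}}F_{n,i}=F_{n,i+1}$ for $1\le i\le q_n-1$ (the sets $T^{h_n+j}F_{n,i}$, $0\le j<a_{n,i}$, are the spacer levels of $S_{n+1}$); (d) $F_{n+1}=F_{n,1}$; (e) the partitions $\xi_n=\{F_n,TF_n,\dots,T^{h_n-1}F_n,X\setminus S_n\}$ form a refining sequence converging to the partition into points (i.e. they generate $\mathcal{B}$ modulo null sets). *)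

theory Defs
  imports "HOL-Probability.Probability"
begin

section \<open>Measure-preserving systems\<close>

definition standard_prob_space :: "'a measure \<Rightarrow> bool" where
  "standard_prob_space M \<longleftrightarrow> prob_space M \<and>
     (\<exists>X. completely_metrizable_space X \<and> second_countable X \<and> topspace X = space M \<and>
          sets M = sigma_sets (space M) {U. openin X U})"

definition mp_system :: "'a measure \<Rightarrow> ('a \<Rightarrow> 'a) \<Rightarrow> bool" where
  "mp_system M T \<longleftrightarrow> standard_prob_space M \<and>
     bij_betw T (space M) (space M) \<and>
     T \<in> measurable M M \<and> the_inv_into (space M) T \<in> measurable M M \<and>
     distr M M T = M"

text \<open>Set relations modulo null sets. Elements of \<^term>\<open>null_sets M\<close> are measurable.\<close>

definition eq_mod :: "'a measure \<Rightarrow> 'a set \<Rightarrow> 'a set \<Rightarrow> bool" where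
  "eq_mod M A B \<longleftrightarrow> sym_diff A B \<in> null_sets M"

definition subset_mod :: "'a measure \<Rightarrow> 'a set \<Rightarrow> 'a set \<Rightarrow> bool" where
  "subset_mod M A B \<longleftrightarrow> A - B \<in> null_sets M"

definition disjoint_mod :: "'a measure \<Rightarrow> 'a set \<Rightarrow> 'a set \<Rightarrow> bool" where
  "disjoint_mod M A B \<longleftrightarrow> A \<inter> B \<in> null_sets M"

section \<open>Sequence entropy\<close>

definition ent_fun :: "real \<Rightarrow> real" where
  "ent_fun x = (if x = 0 then 0 else - x * ln x)"

text \<open>
  Only exact partitions into nonempty sets are used: a partition modulo null sets becomes one
  after changing its members on null sets, which changes no entropy below.
\<close>

definition finite_mpart :: "'a measure \<Rightarrow> 'a set set \<Rightarrow> bool" where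
  "finite_mpart M P \<longleftrightarrow> finite P \<and> P \<subseteq> sets M \<and> partition_on (space M) P"

definition part_entropy :: "'a measure \<Rightarrow> 'a set set \<Rightarrow> real" where
  "part_entropy M P = (\<Sum>A\<in>P. ent_fun (measure M A))"

definition pullback_part :: "'a measure \<Rightarrow> ('a \<Rightarrow> 'a) \<Rightarrow> nat \<Rightarrow> 'a set set \<Rightarrow> 'a set set" where
  "pullback_part M T t P = (\<lambda>A. (T ^^ t) -` A \<inter> space M) ` P"

text \<open>
  Sequences are indexed from 1. The term \<open>n = 0\<close> (where the join is junk) does not affect the
  upper limit.
\<close>

definition seq_entropy_part ::
  "'a measure \<Rightarrow> ('a \<Rightarrow> 'a) \<Rightarrow> (nat \<Rightarrow> nat) \<Rightarrow> 'a set set \<Rightarrow> ereal" where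
  "seq_entropy_part M T t P =
     limsup (\<lambda>n. ereal (part_entropy M
       (common_refinement ((\<lambda>k. pullback_part M T (t k) P) ` {1..n})) / real n))"

definition seq_entropy :: "'a measure \<Rightarrow> ('a \<Rightarrow> 'a) \<Rightarrow> (nat \<Rightarrow> nat) \<Rightarrow> ereal" where
  "seq_entropy M T t = (SUP P \<in> {P. finite_mpart M P}. seq_entropy_part M T t P)"

section \<open>Rank one systems\<close>

definition tower :: "('a \<Rightarrow> 'a) \<Rightarrow> 'a set \<Rightarrow> nat \<Rightarrow> 'a set" where
  "tower T B h = (\<Union>j<h. (T ^^ j) ` B)"

definition tower_part :: "'a measure \<Rightarrow> ('a \<Rightarrow> 'a) \<Rightarrow> 'a set \<Rightarrow> nat \<Rightarrow> 'a set set" where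
  "tower_part M T B h = insert (space M - tower T B h) ((\<lambda>j. (T ^^ j) ` B) ` {..<h})"

text \<open>
  \<open>h\<close>: heights, \<open>q n\<close>: number of columns, \<open>a n i\<close>: spacers above the \<open>i\<close>-th column,
  \<open>F n\<close>: bases, \<open>C n i\<close>: the piece of \<open>F n\<close> carrying the \<open>i\<close>-th column. All level indices \<open>n\<close>
  and column indices \<open>i\<close> start at 1; values at 0 are irrelevant.
\<close>

definition rank_one_params ::
  "(nat \<Rightarrow> nat) \<Rightarrow> (nat \<Rightarrow> nat) \<Rightarrow> (nat \<Rightarrow> nat \<Rightarrow> nat) \<Rightarrow> bool" where
  "rank_one_params h q a \<longleftrightarrow>
     h 1 \<ge> 1 \<and> (\<forall>n\<ge>1. q n \<ge> 1) \<and>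
     (\<forall>n\<ge>1. h (Suc n) = q n * h n + (\<Sum>i=1..q n - 1. a n i)) \<and>
     strict_mono_on {1..} h \<and>
     (\<lambda>n. real (\<Sum>i=1..q n - 1. a n i) / real (h (Suc n))) summable_on {1..}"

definition rank_one_towers ::
  "'a measure \<Rightarrow> ('a \<Rightarrow> 'a) \<Rightarrow> (nat \<Rightarrow> nat) \<Rightarrow> (nat \<Rightarrow> nat) \<Rightarrow> (nat \<Rightarrow> nat \<Rightarrow> nat) \<Rightarrow>
   (nat \<Rightarrow> 'a set) \<Rightarrow> (nat \<Rightarrow> nat \<Rightarrow> 'a set) \<Rightarrow> bool" where
  "rank_one_towers M T h q a F C \<longleftrightarrow>
     (\<forall>n\<ge>1. F n \<in> sets M \<and> measure M (F n) > 0) \<and>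
     (\<forall>n\<ge>1. \<forall>j<h n. \<forall>k<h n. j \<noteq> k \<longrightarrow> disjoint_mod M ((T ^^ j) ` F n) ((T ^^ k) ` F n)) \<and>
     (\<forall>n\<ge>1. (\<forall>i\<in>{1..q n}. C n i \<in> sets M) \<and>
            (\<forall>i\<in>{1..q n}. \<forall>k\<in>{1..q n}. i \<noteq> k \<longrightarrow> disjoint_mod M (C n i) (C n k)) \<and>
            eq_mod M (F n) (\<Union>i\<in>{1..q n}. C n i)) \<and>
     (\<forall>n\<ge>1. \<forall>i\<in>{1..q n - 1}. eq_mod M ((T ^^ (h n + a n i)) ` C n i) (C n (Suc i))) \<and>
     (\<forall>n\<ge>1. eq_mod M (F (Suc n)) (C n 1)) \<and>
     (\<forall>n\<ge>1. \<forall>A\<in>tower_part M T (F (Suc n)) (h (Suc n)).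
        \<exists>B\<in>tower_part M T (F n) (h n). subset_mod M A B) \<and>
     (\<forall>A\<in>sets M. \<exists>B\<in>sigma_sets (space M) (\<Union>n\<in>{1..}. tower_part M T (F n) (h n)).
        eq_mod M A B)"

definition rank_one_system :: "'a measure \<Rightarrow> ('a \<Rightarrow> 'a) \<Rightarrow> (nat \<Rightarrow> nat) \<Rightarrow> bool" where
  "rank_one_system M T h \<longleftrightarrow> mp_system M T \<and>
     (\<exists>q a F C. rank_one_params h q a \<and> rank_one_towers M T h q a F C)"

end

theory Submission
  imports Defs
begin

text \<open>
  Both systems come from one cutting and stacking construction on the line. Above a tower whose word
  in a three-letter alphabet is \<open>B\<close>, of length \<open>h\<close>, one stacks the blocks
  \<open>B v\<^sub>0 B v\<^sub>1 \<dots>\<close> for all bit words \<open>v\<close> of length \<open>2 D\<close>, a bit saying whether one spacer is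
  inserted. Spacers stay isolated, so adjacent letters of every tower word differ. If consecutive
  times differ by more than \<open>h\<close>, toggling the first bit after one time shifts the word by one place
  at the next time and changes the letter seen there. Hence a name along \<open>K\<close> such times has measure at
  most \<open>2 ^ - K\<close> inside a set of measure at least \<open>1/6\<close>, which forces entropy of order \<open>K\<close>.
  Using every other term of the sequence with index from \<open>N\<close> to \<open>3 N\<close>, the gaps exceed \<open>h\<close> once
  \<open>N\<close> is about \<open>h powr (1 / (\<alpha> - 1))\<close> in (i) and \<open>exp (h powr (1 / \<alpha>))\<close> in (ii), the window is covered
  by \<open>D = O(N)\<close> blocks, and the logarithm of the next height is \<open>O(D)\<close>.
\<close>

section \<open>Counting bit words with a given name\<close>

text \<open>A toggled bit moves the later letters by one place. This is sure to be seen at every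
  later time only if no two adjacent letters agree, and that requirement shapes the construction.
  The initial tower has two levels with different letters, a bit inserts at most one spacer, and
  each stage closes with a copy of the lower tower that carries no bit. So every tower word begins
  with \<open>0\<close>, ends with \<open>1\<close>, and fits next to itself and to a spacer.
  Listing every bit word once makes measure proportional to the number of words, so a count replaces
  a probabilistic argument. One fixed partition into three sets works for all stages, and the
  entropy bound is attained along the sparse sequence of window ends. The hypotheses on \<alpha> are
  what makes the window short enough: \<open>1 / (\<alpha> - 1) \<le> \<beta>\<close> in (i) and
  \<open>1 / \<alpha> \<le> \<beta>\<close> in (ii).\<close>

definition blocks :: "'a list \<Rightarrow> 'a \<Rightarrow> bool list \<Rightarrow> 'a list" where
  "blocks B s bs = concat (map (\<lambda>b. B @ (if b then [s] else [])) bs)"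

lemma blocks_simps [simp]:
  "blocks B s [] = []"
  "blocks B s (b # bs) = B @ (if b then [s] else []) @ blocks B s bs"
  "blocks B s (bs @ cs) = blocks B s bs @ blocks B s cs"
  by (simp_all add: blocks_def)

lemma length_blocks: "length (blocks B s bs) = length bs * length B + count_list bs True"
  by (induction bs) auto

text \<open>A joint is \<open>last B\<close> next to \<open>hd B\<close>, or has \<open>s\<close> in
  between, and the hypotheses cover both. The leading letter is arbitrary so that the induction
  hypothesis applies after a copy of \<open>B\<close> as well as after a spacer.\<close>

lemma distinct_adj_Cons_blocks:
  assumes "distinct_adj B" "B \<noteq> []" "hd B \<noteq> s" "last B \<noteq> s" "hd B \<noteq> last B" "a \<noteq> hd B"
  shows "distinct_adj (a # blocks B s bs)"
  using assms(6)
proof (induction bs arbitrary: a)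
  case (Cons b bs)
  have 1: "distinct_adj (last B # blocks B s bs)" "distinct_adj (s # blocks B s bs)"
    using Cons.IH assms by auto
  have B: "B = butlast B @ [last B]" "distinct_adj (a # B)"
    using assms Cons.prems by (auto simp: distinct_adj_Cons)
  show ?case
  proof (cases b)
    case True
    have "distinct_adj ((a # B) @ s # blocks B s bs)"
      unfolding distinct_adj_append_iff using 1 B assms by auto
    then show ?thesis using True by simp
  next
    case False
    have "distinct_adj ((a # B) @ blocks B s bs)"
      unfolding distinct_adj_append_iff using 1(1) B assms by (auto simp: distinct_adj_Cons)
    then show ?thesis using False by simp
  qed
qed auto

text \<open>After the copy of \<open>B\<close> governed by the bit, the two words continue with
  \<open>R\<close> and with \<open>s # R\<close>. Their letters at \<open>z\<close> are therefore
  neighbours in the single list \<open>s # R\<close>. The range of \<open>z\<close> is that of the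
  shorter word.\<close>

lemma blocks_toggle_nth:
  assumes B: "distinct_adj B" "B \<noteq> []" "hd B \<noteq> s" "last B \<noteq> s" "hd B \<noteq> last B"
    and z: "length (blocks B s a) + length B \<le> z"
      "z < length (blocks B s (a @ False # r))"
  shows "blocks B s (a @ b # r) ! z \<noteq> blocks B s (a @ (\<not> b) # r) ! z"
proof -
  define U where "U = blocks B s a @ B"
  define R where "R = blocks B s r"
  obtain d where d: "z = length U + d" using z(1) unfolding U_def by (metis le_iff_add length_append)
  have dR: "d < length R" using z(2) by (simp add: d U_def R_def)
  have "distinct_adj (s # R)" unfolding R_def using distinct_adj_Cons_blocks B by metis
  then have ne: "(s # R) ! d \<noteq> (s # R) ! Suc d"
    using dR by (intro distinct_adj_nth) auto
  have F: "blocks B s (a @ False # r) = U @ R" and T: "blocks B s (a @ True # r) = U @ s # R"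
    by (simp_all add: U_def R_def)
  have "(U @ R) ! z \<noteq> (U @ s # R) ! z" using ne by (simp add: d nth_append)
  then show ?thesis using F T by (cases b) auto
qed

lemma blocks_toggle_nth_before:
  assumes "z < length (blocks B s a) + length B"
  shows "blocks B s (a @ b # r) ! z = blocks B s (a @ c # r) ! z"
  using assms by (auto simp: nth_append)

text \<open>The first bit whose copy of \<open>B\<close> ends after place \<open>z\<close>, so that
  its spacer slot is still to come. The condition on \<open>j\<close> looks only at the bits before
  \<open>j\<close>.\<close>

definition next_bit :: "'a list \<Rightarrow> 'a \<Rightarrow> nat \<Rightarrow> bool list \<Rightarrow> nat" where
  "next_bit B s z u = (LEAST j. z < length (blocks B s (take j u)) + length B)"

definition toggle_next :: "'a list \<Rightarrow> 'a \<Rightarrow> nat \<Rightarrow> bool list \<Rightarrow> bool list" where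
  "toggle_next B s z u = (let j = next_bit B s z u in u[j := \<not> u ! j])"

lemma next_bit:
  assumes "z < length u * length B"
  shows "next_bit B s z u < length u"
    and "z < length (blocks B s (take (next_bit B s z u) u)) + length B"
    and "length (blocks B s (take (next_bit B s z u) u)) \<le> Suc z"
    and "\<And>j. j < next_bit B s z u \<Longrightarrow> length (blocks B s (take j u)) + length B \<le> z"
proof -
  let ?P = "\<lambda>j. z < length (blocks B s (take j u)) + length B"
  have pos: "length u > 0" using assms by (cases u) auto
  have "length u * length B = (length u - 1) * length B + length B"
    using pos by (cases u) auto
  also have "(length u - 1) * length B \<le> length (blocks B s (take (length u - 1) u))"
    by (simp add: length_blocks)
  finally have P: "?P (length u - 1)" using assms by linarith
  from LeastI[of ?P, OF P] show 2: "?P (next_bit B s z u)" unfolding next_bit_def .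
  from Least_le[of ?P, OF P] show 1: "next_bit B s z u < length u"
    unfolding next_bit_def using pos by linarith
  show 4: "length (blocks B s (take j u)) + length B \<le> z" if "j < next_bit B s z u" for j
    using not_less_Least[of j ?P] that unfolding next_bit_def by simp
  show "length (blocks B s (take (next_bit B s z u) u)) \<le> Suc z"
  proof (cases "next_bit B s z u")
    case (Suc j)
    \<comment> \<open>Copy \<open>j\<close> ends by place \<open>z\<close>; only its possible spacer
      can overshoot, whence the bound \<open>Suc z\<close>.\<close>
    have "take (Suc j) u = take j u @ [u ! j]" using 1 Suc by (simp add: take_Suc_conv_app_nth)
    then show ?thesis using 4[of j] Suc by auto
  qed simp
qed

lemma toggle_next_decomp:
  assumes "z < length u * length B"
  obtains a b r where "u = a @ b # r" "toggle_next B s z u = a @ (\<not> b) # r"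
    "z < length (blocks B s a) + length B" "length (blocks B s a) \<le> Suc z"
    "length a = next_bit B s z u"
proof
  let ?j = "next_bit B s z u"
  have j: "?j < length u" by (rule next_bit(1)[OF assms])
  show "u = take ?j u @ u ! ?j # drop (Suc ?j) u" using j by (simp add: id_take_nth_drop)
  show "toggle_next B s z u = take ?j u @ (\<not> u ! ?j) # drop (Suc ?j) u"
    using j by (simp add: toggle_next_def Let_def upd_conv_take_nth_drop)
  show "z < length (blocks B s (take ?j u)) + length B" "length (blocks B s (take ?j u)) \<le> Suc z"
    by (fact next_bit(2,3)[OF assms])+
  show "length (take ?j u) = ?j" using j by simp
qed

text \<open>The choice of the bit depends only on the bits before it, which toggling leaves alone,
  so the second application finds the same bit.\<close>

lemma toggle_next_toggle_next:
  assumes "z < length u * length B"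
  shows "toggle_next B s z (toggle_next B s z u) = u"
proof -
  let ?j = "next_bit B s z u" and ?v = "toggle_next B s z u"
  have v: "?v = u[?j := \<not> u ! ?j]" by (simp add: toggle_next_def Let_def)
  have tk: "take j ?v = take j u" if "j \<le> ?j" for j
    using that by (simp add: v)
  have "next_bit B s z ?v = ?j"
    unfolding next_bit_def[of B s z ?v]
  proof (rule Least_equality)
    show "z < length (blocks B s (take ?j ?v)) + length B" using tk next_bit(2)[OF assms, of s] by simp
    show "?j \<le> y" if y: "z < length (blocks B s (take y ?v)) + length B" for y
    proof (rule ccontr)
      assume "\<not> ?j \<le> y"
      then show False using y next_bit(4)[OF assms, of y s] tk[of y] by simp
    qed
  qed
  then have "toggle_next B s z ?v = ?v[?j := \<not> ?v ! ?j]"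
    by (simp only: toggle_next_def[of B s z ?v] Let_def)
  then show ?thesis using next_bit(1)[OF assms, of s] by (simp add: v)
qed

text \<open>
  The bit that follows position \<open>z k\<close> does not influence the letters up to \<open>z k\<close>, but toggling it
  shifts everything from \<open>z (Suc k)\<close> on by one place and hence changes the letter there.
\<close>

lemma card_bits_with_name:
  assumes B: "distinct_adj B" "B \<noteq> []" "hd B \<noteq> s" "last B \<noteq> s" "hd B \<noteq> last B"
    and gap: "\<And>k. k < K \<Longrightarrow> z k + length B + 1 \<le> z (Suc k)"
    and fit: "z K < l * length B"
  shows "card {u. length u = l \<and> (\<forall>k\<le>K. blocks B s u ! z k = c k)} * 2 ^ K \<le> 2 ^ l"
  using gap fit
proof (induction K)
  case 0
  have fin: "finite {u :: bool list. length u = l}"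
    using finite_lists_length_eq[of "UNIV :: bool set" l] by simp
  have "card {u. length u = l \<and> (\<forall>k\<le>0. blocks B s u ! z k = c k)} \<le> card {u :: bool list. length u = l}"
    by (intro card_mono fin) auto
  also have "\<dots> = 2 ^ l"
    using card_lists_length_eq[of "UNIV :: bool set" l] by simp
  finally show ?case by simp
next
  case (Suc K)
  define E where "E k = {u. length u = l \<and> (\<forall>k'\<le>k. blocks B s u ! z k' = c k')}" for k
  define f where "f = toggle_next B s (z K)"
  have fin: "finite (E k)" for k
    by (rule finite_subset[OF _ finite_lists_length_eq[of "UNIV :: bool set" l]]) (auto simp: E_def)
  have "z k \<le> z m" if "k \<le> m" "m \<le> K" for k m
    using that
  proof (induction m rule: dec_induct)
    case (step m)
    then show ?case using Suc.prems(1)[of m] by simp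
  qed simp
  then have le: "z k \<le> z K" if "k \<le> K" for k using that by blast
  have zK: "z K < l * length B" "z K + length B + 1 \<le> z (Suc K)"
    using Suc.prems(1)[of K] Suc.prems(2) by linarith+
  have lenE: "u \<in> E k \<Longrightarrow> length u = l" for u k by (simp add: E_def)
  have fE: "f u \<in> E K \<and> f u \<notin> E (Suc K)" if u: "u \<in> E (Suc K)" for u
  proof -
    have "z K < length u * length B" using u zK by (simp add: lenE)
    then obtain a b r where d: "u = a @ b # r" "f u = a @ (\<not> b) # r"
      "z K < length (blocks B s a) + length B" "length (blocks B s a) \<le> Suc (z K)"
      unfolding f_def by (elim toggle_next_decomp)
    have l: "length (a @ False # r) = l" using lenE[OF u] d by simp
    have same: "blocks B s (f u) ! z k = blocks B s u ! z k" if "k \<le> K" for k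
      unfolding d(2) unfolding d(1) using le[OF that] d(3) by (intro blocks_toggle_nth_before) simp
    have "l * length B \<le> length (blocks B s (a @ False # r))" 
      unfolding length_blocks l by simp
    then have "blocks B s u ! z (Suc K) \<noteq> blocks B s (f u) ! z (Suc K)"
      unfolding d(2) unfolding d(1) using Suc.prems(2) d(4) zK(2) by (intro blocks_toggle_nth[OF B]) linarith+
    moreover have "length (f u) = l" using l d by simp
    moreover have "blocks B s u ! z k = c k" if "k \<le> Suc K" for k
      using u that by (simp add: E_def)
    ultimately show ?thesis using same by (simp add: E_def) (metis le_refl)
  qed
  have inj: "inj_on f (E (Suc K))"
    by (rule inj_on_inverseI[where g = f])
       (use zK lenE in \<open>simp add: f_def toggle_next_toggle_next\<close>)
  \<comment> \<open>The image of \<open>E (Suc K)\<close> lies in \<open>E K\<close> but misses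
    \<open>E (Suc K)\<close>, so each further time at least halves the count.\<close>
  have "card (E (Suc K)) + card (E (Suc K)) = card (E (Suc K)) + card (f ` E (Suc K))"
    by (simp add: card_image inj)
  also have "\<dots> = card (E (Suc K) \<union> f ` E (Suc K))"
    using fE by (intro card_Un_disjoint[symmetric] fin finite_imageI) auto
  also have "\<dots> \<le> card (E K)"
    using fE by (intro card_mono fin) (auto simp: E_def)
  finally have "card (E (Suc K)) * 2 ^ Suc K \<le> card (E K) * 2 ^ K" by simp
  also have "\<dots> \<le> 2 ^ l" using Suc.IH Suc.prems(1) zK unfolding E_def by simp
  finally show ?case unfolding E_def .
qed

text \<open>Starting in copy \<open>i\<close> hides the first \<open>i\<close> bits. They are free
  and contribute the factor \<open>2 ^ i\<close> that restores \<open>2 ^ l\<close>.\<close>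

lemma card_bits_with_name_drop:
  assumes B: "distinct_adj B" "B \<noteq> []" "hd B \<noteq> s" "last B \<noteq> s" "hd B \<noteq> last B"
    and gap: "\<And>k. k < K \<Longrightarrow> z k + length B + 1 \<le> z (Suc k)"
    and fit: "z K < (l - i) * length B" and "i \<le> l"
  shows "card {v. length v = l \<and> (\<forall>k\<le>K. blocks B s (drop i v) ! z k = c k)} * 2 ^ K \<le> 2 ^ l"
proof -
  let ?V = "{v. length v = l \<and> (\<forall>k\<le>K. blocks B s (drop i v) ! z k = c k)}"
  let ?U = "{u. length u = l - i \<and> (\<forall>k\<le>K. blocks B s u ! z k = c k)}"
  let ?L = "{u :: bool list. length u = i}"
  have fin: "finite {u :: bool list. length u = n}" for n
    using finite_lists_length_eq[of "UNIV :: bool set" n] by simp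
  have "card ?V \<le> card (?L \<times> ?U)"
  proof (rule card_inj_on_le)
    show "inj_on (\<lambda>v. (take i v, drop i v)) ?V"
      by (rule inj_onI) (metis append_take_drop_id prod.inject)
    show "(\<lambda>v. (take i v, drop i v)) ` ?V \<subseteq> ?L \<times> ?U" using \<open>i \<le> l\<close> by auto
    show "finite (?L \<times> ?U)" by (intro finite_cartesian_product fin finite_subset[OF _ fin[of "l - i"]]) auto
  qed
  also have "\<dots> = 2 ^ i * card ?U"
    using card_lists_length_eq[of "UNIV :: bool set" i] by (simp add: card_cartesian_product)
  finally have "card ?V * 2 ^ K \<le> 2 ^ i * (card ?U * 2 ^ K)" by (simp add: mult.assoc[symmetric])
  also have "\<dots> \<le> 2 ^ i * 2 ^ (l - i)"
    using card_bits_with_name[OF B gap fit] by (intro mult_left_mono) auto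
  also have "\<dots> = 2 ^ l" using \<open>i \<le> l\<close> by (simp add: power_add[symmetric])
  finally show ?thesis .
qed

lemma drop_concat_uniform:
  assumes "\<forall>v\<in>set vs. length v = l" "V < length vs" "i \<le> l"
  shows "drop (V * l + i) (concat vs) = drop i (vs ! V) @ concat (drop (Suc V) vs)"
  using assms
proof (induction vs arbitrary: V)
  case (Cons v vs)
  show ?case
  proof (cases V)
    case (Suc V')
    have "drop (V * l + i) (concat (v # vs)) = drop (V' * l + i) (concat vs)"
      using Cons.prems by (simp add: Suc)
    then show ?thesis using Cons by (simp add: Suc)
  qed (use Cons in auto)
qed simp

text \<open>Every word occurs exactly once, so a proportion of words becomes a proportion of columns
  of equal width.\<close>

definition all_words :: "nat \<Rightarrow> bool list list" where
  "all_words l = List.n_lists l [False, True]"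

lemma all_words:
  "set (all_words l) = {v. length v = l}" "distinct (all_words l)" "length (all_words l) = 2 ^ l"
  "length (concat (all_words l)) = 2 ^ l * l"
proof -
  show 1: "set (all_words l) = {v. length v = l}"
    by (auto simp: all_words_def set_n_lists)
  show "distinct (all_words l)" by (simp add: all_words_def distinct_n_lists)
  show 2: "length (all_words l) = 2 ^ l" by (simp add: all_words_def length_n_lists numeral_2_eq_2)
  have "map length (all_words l) = map (\<lambda>_. l) (all_words l)"
    using 1 by (intro map_cong) auto
  then show "length (concat (all_words l)) = 2 ^ l * l"
    unfolding length_concat by (simp only: sum_list_triv 2 of_nat_id)
qed

section \<open>Entropy and translations\<close>

lemma ent_fun_nonneg: "0 \<le> x \<Longrightarrow> x \<le> 1 \<Longrightarrow> 0 \<le> ent_fun x"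
  by (auto simp: ent_fun_def mult_le_0_iff)

lemma (in prob_space) sum_prob_partition_Int:
  assumes "finite P" "P \<subseteq> events" "partition_on (space M) P" "G \<in> events"
  shows "(\<Sum>A\<in>P. prob (A \<inter> G)) = prob G"
proof -
  have "(\<Union>A\<in>P. A \<inter> G) = G"
    using assms(3) sets.sets_into_space[OF assms(4)] by (auto simp: partition_on_def)
  moreover have "disjoint_family_on (\<lambda>A. A \<inter> G) P"
    using assms(3) by (auto simp: partition_on_def disjoint_def disjoint_family_on_def)
  moreover have "(\<lambda>A. A \<inter> G) ` P \<subseteq> events" using assms(2,4) by auto
  ultimately show ?thesis
    using finite_measure_finite_Union[OF assms(1), of "\<lambda>A. A \<inter> G"] by simp
qed

text \<open>
  At most \<open>1 / sqrt \<epsilon>\<close> atoms have measure above \<open>sqrt \<epsilon>\<close>, and these cover at most \<open>sqrt \<epsilon>\<close> of \<open>G\<close>.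
\<close>

lemma (in prob_space) part_entropy_ge:
  assumes P: "finite P" "P \<subseteq> events" "partition_on (space M) P" and G: "G \<in> events"
    and small: "\<And>A. A \<in> P \<Longrightarrow> prob (A \<inter> G) \<le> \<epsilon>" and \<epsilon>: "0 < \<epsilon>" "\<epsilon> \<le> 1"
  shows "(prob G - sqrt \<epsilon>) * (ln (1 / \<epsilon>) / 2) \<le> part_entropy M P"
proof -
  define P1 where "P1 = {A\<in>P. prob A \<le> sqrt \<epsilon>}"
  define P2 where "P2 = {A\<in>P. \<not> prob A \<le> sqrt \<epsilon>}"
  have fin: "finite P1" "finite P2" and un: "P = P1 \<union> P2" and dis: "P1 \<inter> P2 = {}"
    using P by (auto simp: P1_def P2_def)
  have sq: "sqrt \<epsilon> * sqrt \<epsilon> = \<epsilon>" "sqrt \<epsilon> > 0" using \<epsilon> by auto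
  have "real (card P2) * sqrt \<epsilon> \<le> (\<Sum>A\<in>P2. prob A)"
    using sum_bounded_below[of P2 "sqrt \<epsilon>" prob] by (auto simp: P2_def)
  also have "\<dots> \<le> (\<Sum>A\<in>P. prob A)" using P(1) un by (intro sum_mono2) auto
  also have "\<dots> = (\<Sum>A\<in>P. prob (A \<inter> space M))"
    using P(2) by (intro sum.cong) (auto dest!: sets.sets_into_space simp: Int_absorb2)
  also have "\<dots> = 1" using sum_prob_partition_Int[OF P, of "space M"] prob_space by simp
  finally have "real (card P2) * sqrt \<epsilon> * sqrt \<epsilon> \<le> 1 * sqrt \<epsilon>"
    using sq by (intro mult_right_mono) auto
  then have card: "real (card P2) * \<epsilon> \<le> sqrt \<epsilon>" using sq by (simp add: mult.assoc)
  have "prob G = (\<Sum>A\<in>P1. prob (A \<inter> G)) + (\<Sum>A\<in>P2. prob (A \<inter> G))"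
    using sum_prob_partition_Int[OF P G] un dis fin by (simp add: sum.union_disjoint)
  also have "(\<Sum>A\<in>P2. prob (A \<inter> G)) \<le> real (card P2) * \<epsilon>"
    using sum_bounded_above[of P2 "\<lambda>A. prob (A \<inter> G)" \<epsilon>] small un by auto
  also have "(\<Sum>A\<in>P1. prob (A \<inter> G)) \<le> (\<Sum>A\<in>P1. prob A)"
    using P(2) un G by (intro sum_mono finite_measure_mono) auto
  finally have "prob G - sqrt \<epsilon> \<le> (\<Sum>A\<in>P1. prob A)" using card by linarith
  then have "(prob G - sqrt \<epsilon>) * (ln (1 / \<epsilon>) / 2) \<le> (\<Sum>A\<in>P1. prob A) * (ln (1 / \<epsilon>) / 2)"
    using \<epsilon> by (intro mult_right_mono) auto
  also have "\<dots> = (\<Sum>A\<in>P1. prob A * (ln (1 / \<epsilon>) / 2))" by (simp add: sum_distrib_right)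
  also have "\<dots> \<le> (\<Sum>A\<in>P1. ent_fun (prob A))"
  proof (rule sum_mono)
    fix A assume A: "A \<in> P1"
    show "prob A * (ln (1 / \<epsilon>) / 2) \<le> ent_fun (prob A)"
    proof (cases "prob A = 0")
      case False
      then have pos: "prob A > 0" using measure_nonneg[of M A] by linarith
      have "ln (prob A) \<le> ln (sqrt \<epsilon>)" using A pos by (intro ln_mono) (auto simp: P1_def)
      then have "ln (1 / \<epsilon>) / 2 \<le> - ln (prob A)" using \<epsilon> by (simp add: ln_sqrt ln_div)
      then have "prob A * (ln (1 / \<epsilon>) / 2) \<le> prob A * (- ln (prob A))"
        using pos by (intro mult_left_mono) auto
      then show ?thesis using False by (simp add: ent_fun_def)
    qed (simp add: ent_fun_def)
  qed
  also have "\<dots> \<le> part_entropy M P"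
    unfolding part_entropy_def using P(1) un by (intro sum_mono2 ent_fun_nonneg) auto
  finally show ?thesis .
qed

lemma emeasure_lborel_translate:
  assumes "S \<in> sets borel"
  shows "emeasure lborel ((\<lambda>x. x + d) -` S) = emeasure lborel (S :: real set)"
proof -
  have "emeasure lborel S = emeasure (distr lborel borel ((+) d)) S"
    by (simp add: lborel_distr_plus)
  also have "\<dots> = emeasure lborel ((+) d -` S)"
    using assms by (simp add: emeasure_distr)
  also have "(+) d -` S = (\<lambda>x. x + d) -` S"
    by (auto simp: add.commute)
  finally show ?thesis by simp
qed

text \<open>A bijection that moves points by rationals is a countable patchwork of translations.\<close>

lemma emeasure_lborel_rational_translation:
  fixes T :: "real \<Rightarrow> real"
  assumes X: "X \<in> sets borel" and bij: "bij_betw T X X" and T: "T \<in> borel_measurable borel"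
    and rat: "\<And>x. x \<in> X \<Longrightarrow> T x - x \<in> \<rat>" and A: "A \<in> sets borel"
  shows "emeasure lborel (X \<inter> T -` A) = emeasure lborel (X \<inter> A)"
proof -
  define S where "S d = {x \<in> X. T x \<in> A \<and> T x - x = d}" for d
  define S' where "S' d = {y \<in> A. y - d \<in> X \<and> T (y - d) = y}" for d
  note [measurable] = X T A
  have S[measurable]: "S d \<in> sets borel" for d
  proof -
    have "S d = X \<inter> {x \<in> space borel. T x \<in> A \<and> T x - x = d}" by (auto simp: S_def)
    also have "\<dots> \<in> sets borel" by measurable
    finally show ?thesis .
  qed
  have S'[measurable]: "S' d \<in> sets borel" for d
  proof -
    have "S' d = A \<inter> {y \<in> space borel. y - d \<in> X \<and> T (y - d) = y}" by (auto simp: S'_def)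
    also have "\<dots> \<in> sets borel" by measurable
    finally show ?thesis .
  qed
  have XT: "X \<inter> T -` A = (\<Union>d\<in>\<rat>. S d)" using rat by (auto simp: S_def)
  have XA: "X \<inter> A = (\<Union>d\<in>\<rat>. S' d)"
  proof (intro equalityI subsetI)
    fix y assume y: "y \<in> X \<inter> A"
    then have "y \<in> T ` X" using bij by (simp add: bij_betw_def)
    then obtain x where x: "x \<in> X" "T x = y" by blast
    then have "y \<in> S' (y - x)" "y - x \<in> \<rat>" using y rat by (auto simp: S'_def)
    then show "y \<in> (\<Union>d\<in>\<rat>. S' d)" by blast
  next
    fix y assume "y \<in> (\<Union>d\<in>\<rat>. S' d)"
    then obtain d where d: "y \<in> A" "y - d \<in> X" "T (y - d) = y" by (auto simp: S'_def)
    have "T (y - d) \<in> X" using d(2) bij by (rule bij_betw_apply[rotated])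
    then show "y \<in> X \<inter> A" using d by simp
  qed
  have "disjoint_family_on S \<rat>" by (auto simp: disjoint_family_on_def S_def)
  \<comment> \<open>A point of both \<open>S' d\<close> and \<open>S' e\<close> would be the image
    of \<open>y - d\<close> and of \<open>y - e\<close>; injectivity gives
    \<open>d = e\<close>.\<close>
  moreover have "disjoint_family_on S' \<rat>"
    using bij by (auto simp: disjoint_family_on_def S'_def bij_betw_def inj_on_def)
      (metis add_diff_cancel_left' diff_add_cancel)
  moreover have "emeasure lborel (S d) = emeasure lborel (S' d)" for d
  proof -
    have "S d = (\<lambda>x. x + d) -` S' d" by (auto simp: S_def S'_def algebra_simps)
    then show ?thesis using emeasure_lborel_translate[OF S'] by simp
  qed
  ultimately show ?thesis unfolding XT XA
    by (subst (1 2) emeasure_UN_countable) (auto simp: countable_rat)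
qed

section \<open>Cutting and stacking\<close>

lemma nth_concat_upt:
  assumes "i < n" "j < length (f i)"
  shows "concat (map f [0..<n]) ! (length (concat (map f [0..<i])) + j) = f i ! j"
proof -
  have "[0..<n] = [0..<i] @ i # [Suc i..<n]"
    using assms(1) by (metis le0 less_imp_le_nat upt_add_eq_append upt_conv_Cons le_add_diff_inverse)
  then have "concat (map f [0..<n]) = concat (map f [0..<i]) @ f i @ concat (map f [Suc i..<n])"
    by simp
  then show ?thesis using assms(2) by (simp add: nth_append)
qed

lemma less_length_concat_upt:
  assumes "k < length (concat (map f [0..<n]))"
  shows "\<exists>i<n. \<exists>j<length (f i). k = length (concat (map f [0..<i])) + j"
  using assms
proof (induction n)
  case (Suc n)
  show ?case
  proof (cases "k < length (concat (map f [0..<n]))")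
    case True
    then show ?thesis using Suc.IH less_Suc_eq by auto
  next
    case False
    then obtain j where "k = length (concat (map f [0..<n])) + j" using le_Suc_ex not_less by blast
    moreover have "j < length (f n)" using Suc.prems calculation by simp
    ultimately show ?thesis by blast
  qed
qed simp

lemma subinterval_exists:
  fixes p w x :: real
  assumes "w > 0" "p \<le> x" "x < p + real n * w"
  shows "\<exists>i<n. p + real i * w \<le> x \<and> x < p + real i * w + w"
  using assms(3)
proof (induction n)
  case (Suc n)
  show ?case
  proof (cases "x < p + real n * w")
    case True
    then show ?thesis using Suc.IH less_Suc_eq by auto
  next
    case False
    then show ?thesis using Suc.prems by (intro exI[of _ n]) (auto simp: algebra_simps)
  qed
qed (use assms(2) in simp)

lemma subinterval_unique:
  fixes p w x :: real
  assumes "w > 0" "p + real i * w \<le> x" "x < p + real i * w + w"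
    "p + real j * w \<le> x" "x < p + real j * w + w"
  shows "i = j"
proof -
  have "real i * w < (real j + 1) * w" "real j * w < (real i + 1) * w"
    using assms by (auto simp: algebra_simps)
  then have "real i < real j + 1" "real j < real i + 1"
    using assms(1) by (auto simp: mult_less_cancel_right)
  then show ?thesis by linarith
qed

text \<open>\<open>bits h\<close> is the spacer pattern used above a tower of height \<open>h\<close>.\<close>

locale cutting_stacking =
  fixes bits :: "nat \<Rightarrow> bool list"
  assumes bits_nonempty: "bits h \<noteq> []"
begin

text \<open>The last summand is the final copy without a bit: spacers may stand only between
  columns, so there is one column more than bits. Height 2 at the start lets the first and the last
  letter differ.\<close>

primrec hgt :: "nat \<Rightarrow> nat" where
  "hgt 0 = 2"
| "hgt (Suc m) = length (bits (hgt m)) * hgt m + count_list (bits (hgt m)) True + hgt m"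

definition bs :: "nat \<Rightarrow> bool list" where
  "bs m = bits (hgt m)"

definition ncol :: "nat \<Rightarrow> nat" where
  "ncol m = Suc (length (bs m))"

primrec wid :: "nat \<Rightarrow> real" where
  "wid 0 = 1"
| "wid (Suc m) = wid m / real (ncol m)"

text \<open>
  The spacers of stage \<open>m\<close> are cut from the interval \<open>[ext m, ext m + wid m)\<close>; a slot is reserved
  for each column and left out of the space if its bit is off.
\<close>

primrec ext :: "nat \<Rightarrow> real" where
  "ext 0 = 2"
| "ext (Suc m) = ext m + wid m"

text \<open>A tower is encoded by the left endpoints of its levels from bottom to top, the common
  width being \<open>wid m\<close>.\<close>

primrec levs :: "nat \<Rightarrow> real list" where
  "levs 0 = [0, 1]"
| "levs (Suc m) = concat (map (\<lambda>i. map (\<lambda>x. x + real i * wid (Suc m)) (levs m) @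
     (if i < length (bs m) \<and> bs m ! i then [ext m + real i * wid (Suc m)] else [])) [0..<ncol m])"

definition col :: "nat \<Rightarrow> nat \<Rightarrow> real list" where
  "col m i = map (\<lambda>x. x + real i * wid (Suc m)) (levs m) @
     (if i < length (bs m) \<and> bs m ! i then [ext m + real i * wid (Suc m)] else [])"

text \<open>The height at which column \<open>i\<close> starts in the next tower.\<close>

definition coff :: "nat \<Rightarrow> nat \<Rightarrow> nat" where
  "coff m i = i * hgt m + count_list (take i (bs m)) True"

definition pos :: "nat \<Rightarrow> nat \<Rightarrow> real" where
  "pos m k = levs m ! k"

definition iv :: "nat \<Rightarrow> nat \<Rightarrow> real set" where
  "iv m k = {pos m k..<pos m k + wid m}"

text \<open>
  The map sends no point to \<open>0\<close>. Dropping the rationals removes the whole orbit of \<open>0\<close> and leaves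
  a bijection, since all displacements are rational.
\<close>

definition lev :: "nat \<Rightarrow> nat \<Rightarrow> real set" where
  "lev m k = iv m k - \<rat>"

definition X :: "real set" where
  "X = (\<Union>m. \<Union>k<hgt m. lev m k)"

text \<open>All stages are allowed at once, because each single stage leaves its top level without
  an image.\<close>

definition step :: "real \<Rightarrow> real \<Rightarrow> bool" where
  "step x y \<longleftrightarrow> (\<exists>m k. Suc k < hgt m \<and> x \<in> lev m k \<and> y = x + (pos m (Suc k) - pos m k))"

text \<open>Fixing the points outside \<open>X\<close> makes this a bijection of the whole line,
  which is the carrier of the measure.\<close>

definition T :: "real \<Rightarrow> real" where
  "T x = (if x \<in> X then THE y. step x y else x)"

section \<open>Widths, heights and column offsets\<close>

lemma levs_Suc: "levs (Suc m) = concat (map (col m) [0..<ncol m])"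
  by (simp add: col_def[abs_def])

lemma bs_nonempty: "bs m \<noteq> []"
  by (simp add: bs_def bits_nonempty)

lemma ncol_ge: "2 \<le> ncol m"
  using bs_nonempty[of m] by (cases "bs m") (auto simp: ncol_def)

lemma wid_pos: "0 < wid m"
  by (induction m) (auto simp: ncol_def)

lemma ncol_wid_Suc: "real (ncol m) * wid (Suc m) = wid m"
  by (simp add: ncol_def)

declare wid.simps(2) [simp del]

lemma wid_Suc_le: "2 * wid (Suc m) \<le> wid m"
proof -
  have "2 * wid (Suc m) \<le> real (ncol m) * wid (Suc m)"
    using ncol_ge[of m] wid_pos[of "Suc m"] by (intro mult_right_mono) auto
  then show ?thesis by (simp only: ncol_wid_Suc)
qed

lemma wid_le: "wid m \<le> (1 / 2) ^ m"
proof (induction m)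
  case (Suc m)
  then show ?case using wid_Suc_le[of m] by simp
qed simp

text \<open>Widths at least halve, so the intervals reserved for spacers never pass 4. The term
  \<open>2 * wid m\<close> is the reserve for all later stages that makes the induction
  work.\<close>

lemma ext_le: "ext m \<le> 4 - 2 * wid m"
proof (induction m)
  case (Suc m)
  then show ?case using wid_Suc_le[of m] by simp
qed simp

lemma ext_ge: "2 \<le> ext m"
  by (induction m) (auto intro: add_increasing2 less_imp_le wid_pos)

lemma coff_0 [simp]: "coff m 0 = 0"
  by (simp add: coff_def)

lemma coff_Suc:
  "i < length (bs m) \<Longrightarrow> coff m (Suc i) = coff m i + hgt m + (if bs m ! i then 1 else 0)"
  by (simp add: coff_def take_Suc_conv_app_nth)

lemma coff_last: "coff m (length (bs m)) + hgt m = hgt (Suc m)"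
  by (simp add: coff_def bs_def)

lemma hgt_ge: "2 * hgt m \<le> hgt (Suc m)"
  using bits_nonempty[of "hgt m"] by (cases "bits (hgt m)") auto

lemma length_levs: "length (levs m) = hgt m"
  and length_concat_col: "i \<le> length (bs m) \<Longrightarrow> length (concat (map (col m) [0..<i])) = coff m i"
proof -
  have 1: "length (concat (map (col m) [0..<i])) = coff m i"
    if "length (levs m) = hgt m" "i \<le> length (bs m)" for m i
    using that(2)
  proof (induction i)
    case (Suc i)
    then show ?case using that(1) by (auto simp: coff_Suc col_def)
  qed simp
  show 2: "length (levs m) = hgt m" for m
  proof (induction m)
    case (Suc m)
    have "length (levs (Suc m)) = length (concat (map (col m) [0..<length (bs m)])) + hgt m"
      using Suc by (simp add: levs_Suc ncol_def col_def del: levs.simps)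
    then show ?case using 1[OF Suc] coff_last by simp
  qed simp
  show "i \<le> length (bs m) \<Longrightarrow> length (concat (map (col m) [0..<i])) = coff m i"
    by (rule 1[OF 2])
qed

section \<open>Positions of the levels on the line\<close>

lemma pos_col:
  assumes "i < ncol m" "j < hgt m"
  shows "pos (Suc m) (coff m i + j) = pos m j + real i * wid (Suc m)"
  using nth_concat_upt[of i "ncol m" j "col m"] assms length_concat_col[of i m]
  unfolding pos_def levs_Suc by (simp add: ncol_def col_def nth_append length_levs)

lemma pos_spacer:
  assumes "i < length (bs m)" "bs m ! i"
  shows "pos (Suc m) (coff m i + hgt m) = ext m + real i * wid (Suc m)"
  using nth_concat_upt[of i "ncol m" "hgt m" "col m"] assms length_concat_col[of i m]
  unfolding pos_def levs_Suc by (simp add: ncol_def col_def nth_append length_levs)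

lemma level_cases:
  assumes "k < hgt (Suc m)"
  obtains (column) i j where "i < ncol m" "j < hgt m" "k = coff m i + j"
    | (spacer) i where "i < length (bs m)" "bs m ! i" "k = coff m i + hgt m"
proof -
  have "k < length (concat (map (col m) [0..<ncol m]))"
    using assms length_levs[of "Suc m"] by (simp only: levs_Suc)
  then obtain i j where ij: "i < ncol m" "j < length (col m i)" "k = coff m i + j"
    using less_length_concat_upt[of k "col m" "ncol m"] length_concat_col[of _ m]
    by (auto simp: ncol_def)
  show ?thesis
  proof (cases "j < hgt m")
    case True
    then show ?thesis using ij column by blast
  next
    case False
    then have "i < length (bs m) \<and> bs m ! i \<and> j = hgt m"
      using ij(2) by (auto simp: col_def length_levs split: if_splits)
    then show ?thesis using ij spacer by blast
  qed
qed

lemma coff_mono: "i \<le> i' \<Longrightarrow> i' \<le> length (bs m) \<Longrightarrow> coff m i \<le> coff m i'"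
  by (induction i' rule: dec_induct) (auto simp: coff_Suc)

lemma coff_less: "i < i' \<Longrightarrow> i' \<le> length (bs m) \<Longrightarrow> coff m i + hgt m \<le> coff m i'"
  using coff_mono[of "Suc i" i' m] by (simp add: coff_Suc split: if_splits)

lemma column_bound: "i < ncol m \<Longrightarrow> j < hgt m \<Longrightarrow> coff m i + j < hgt (Suc m)"
  using coff_mono[of i "length (bs m)" m] coff_last[of m] by (simp add: ncol_def)

lemma coff_add_inject:
  assumes "coff m i + j = coff m i' + j'" "j < hgt m" "j' < hgt m" "i < ncol m" "i' < ncol m"
  shows "i = i' \<and> j = j'"
proof -
  have "\<not> i < i'" "\<not> i' < i"
    using coff_less[of i i' m] coff_less[of i' i m] assms by (auto simp: ncol_def)
  then show ?thesis using assms by simp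
qed

lemma pos_bounds: "k < hgt m \<Longrightarrow> 0 \<le> pos m k \<and> pos m k + wid m \<le> ext m"
proof (induction m arbitrary: k)
  case 0
  then show ?case by (auto simp: pos_def less_2_cases_iff)
next
  case (Suc m)
  have le: "real i * wid (Suc m) + wid (Suc m) \<le> wid m" "0 \<le> real i * wid (Suc m)"
    if "i < ncol m" for i
  proof -
    have "(real i + 1) * wid (Suc m) \<le> real (ncol m) * wid (Suc m)"
      using that wid_pos[of "Suc m"] by (intro mult_right_mono) auto
    then show "real i * wid (Suc m) + wid (Suc m) \<le> wid m"
      by (simp only: ncol_wid_Suc) (simp add: algebra_simps)
    show "0 \<le> real i * wid (Suc m)" using wid_pos[of "Suc m"] by simp
  qed
  from Suc.prems show ?case
  proof (cases rule: level_cases)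
    case (column i j)
    then show ?thesis
      using Suc.IH[of j] le[of i] wid_pos[of m] by (simp add: pos_col)
  next
    case (spacer i)
    then show ?thesis
      using le[of i] ext_ge[of m] by (simp add: pos_spacer ncol_def)
  qed
qed

lemma iv_col_subset:
  assumes "i < ncol m" "j < hgt m"
  shows "iv (Suc m) (coff m i + j) \<subseteq> iv m j"
proof -
  have "(real i + 1) * wid (Suc m) \<le> real (ncol m) * wid (Suc m)"
    using assms wid_pos[of "Suc m"] by (intro mult_right_mono) auto
  then have "real i * wid (Suc m) + wid (Suc m) \<le> wid m"
    by (simp only: ncol_wid_Suc) (simp add: algebra_simps)
  moreover have "0 \<le> real i * wid (Suc m)" using wid_pos[of "Suc m"] by simp
  ultimately show ?thesis
    unfolding iv_def pos_col[OF assms] by auto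
qed

lemma iv_spacer_ge: "i < length (bs m) \<Longrightarrow> bs m ! i \<Longrightarrow> x \<in> iv (Suc m) (coff m i + hgt m) \<Longrightarrow> ext m \<le> x"
proof -
  assume a: "i < length (bs m)" "bs m ! i" "x \<in> iv (Suc m) (coff m i + hgt m)"
  have "0 \<le> real i * wid (Suc m)" using wid_pos[of "Suc m"] by simp
  moreover have "ext m + real i * wid (Suc m) \<le> x" using a by (simp add: iv_def pos_spacer)
  ultimately show "ext m \<le> x" by linarith
qed

lemma iv_less: "k < hgt m \<Longrightarrow> x \<in> iv m k \<Longrightarrow> 0 \<le> x \<and> x < ext m"
  using pos_bounds[of k m] by (auto simp: iv_def)

text \<open>Pieces of old levels lie left of \<open>ext m\<close> and spacers right of it, so only
  levels of the same kind can meet. Among those, the subinterval containing \<open>x\<close>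
  determines the column.\<close>

lemma iv_disjoint: "k < hgt m \<Longrightarrow> k' < hgt m \<Longrightarrow> x \<in> iv m k \<Longrightarrow> x \<in> iv m k' \<Longrightarrow> k = k'"
proof (induction m arbitrary: k k')
  case 0
  then show ?case by (auto simp: iv_def pos_def less_2_cases_iff)
next
  case (Suc m)
  note w = wid_pos[of "Suc m"]
  from Suc.prems(1) show ?case
  proof (cases rule: level_cases)
    case c: (column i j)
    then have xj: "x \<in> iv m j" using Suc.prems(3) iv_col_subset by blast
    from Suc.prems(2) show ?thesis
    proof (cases rule: level_cases)
      case c': (column i' j')
      then have "x \<in> iv m j'" using Suc.prems(4) iv_col_subset by blast
      then have "j = j'" using Suc.IH xj c c' by blast
      moreover have "i = i'"
        using Suc.prems(3,4) c c' \<open>j = j'\<close>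
        by (intro subinterval_unique[OF w, of "pos m j" i x i']) (auto simp: iv_def pos_col)
      ultimately show ?thesis using c c' by simp
    next
      case (spacer i')
      then show ?thesis using iv_less[OF c(2) xj] iv_spacer_ge Suc.prems(4) by fastforce
    qed
  next
    case c: (spacer i)
    then have x: "ext m \<le> x" using iv_spacer_ge Suc.prems(3) by blast
    from Suc.prems(2) show ?thesis
    proof (cases rule: level_cases)
      case c': (column i' j')
      then have "x \<in> iv m j'" using Suc.prems(4) iv_col_subset by blast
      then show ?thesis using iv_less[OF c'(2)] x by fastforce
    next
      case c': (spacer i')
      have "i = i'"
        using Suc.prems(3,4) c c'
        by (intro subinterval_unique[OF w, of "ext m" i x i']) (auto simp: iv_def pos_spacer)
      then show ?thesis using c c' by simp
    qed
  qed
qed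

lemma lev_refine:
  assumes "k < hgt m" "x \<in> lev m k"
  shows "\<exists>i<ncol m. x \<in> lev (Suc m) (coff m i + k)"
proof -
  have "\<exists>i<ncol m. pos m k + real i * wid (Suc m) \<le> x \<and> x < pos m k + real i * wid (Suc m) + wid (Suc m)"
    using assms(2) wid_pos[of "Suc m"] ncol_wid_Suc[of m]
    by (intro subinterval_exists) (auto simp: lev_def iv_def)
  then show ?thesis
    using assms unfolding lev_def iv_def by (auto simp: pos_col)
qed

section \<open>Rational translations between levels\<close>

lemma rational_wid: "wid m \<in> \<rat>"
  by (induction m) (auto simp: wid.simps)

lemma rational_ext: "ext m \<in> \<rat>"
  by (induction m) (auto simp: rational_wid)

lemma rational_pos: "k < hgt m \<Longrightarrow> pos m k \<in> \<rat>"
proof (induction m arbitrary: k)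
  case 0
  then show ?case by (auto simp: pos_def less_2_cases_iff)
next
  case (Suc m)
  from Suc.prems show ?case
    by (cases rule: level_cases)
      (use Suc.IH in \<open>auto simp: pos_col pos_spacer rational_ext rational_wid\<close>)
qed

lemma translate_lev:
  assumes "k < hgt m" "k' < hgt m" "x \<in> lev m k"
  shows "x + (pos m k' - pos m k) \<in> lev m k'"
proof -
  have r: "pos m k' - pos m k \<in> \<rat>" using rational_pos assms by simp
  have "x + (pos m k' - pos m k) \<notin> \<rat>"
  proof
    assume "x + (pos m k' - pos m k) \<in> \<rat>"
    from Rats_diff[OF this r] show False using assms(3) by (simp add: lev_def)
  qed
  then show ?thesis using assms(3) by (auto simp: lev_def iv_def)
qed

text \<open>Neighbouring levels are cut alike, so passing to a later stage keeps the displacement.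
  Hence the stages never disagree about the image of a point.\<close>

lemma lev_step_refine:
  assumes "Suc k < hgt m" "x \<in> lev m k" "m \<le> m'"
  shows "\<exists>k'. Suc k' < hgt m' \<and> x \<in> lev m' k' \<and> pos m' (Suc k') - pos m' k' = pos m (Suc k) - pos m k"
  using assms(3)
proof (induction m' rule: dec_induct)
  case base
  then show ?case using assms by blast
next
  case (step m')
  then obtain k' where k': "Suc k' < hgt m'" "x \<in> lev m' k'"
    "pos m' (Suc k') - pos m' k' = pos m (Suc k) - pos m k" by blast
  obtain i where i: "i < ncol m'" "x \<in> lev (Suc m') (coff m' i + k')"
    using lev_refine[of k' m' x] k' by auto
  have "pos (Suc m') (Suc (coff m' i + k')) - pos (Suc m') (coff m' i + k') = pos m (Suc k) - pos m k"
    using pos_col[of i m' "Suc k'"] pos_col[of i m' k'] i k' by simp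
  moreover have "Suc (coff m' i + k') < hgt (Suc m')" using column_bound[of i m' "Suc k'"] i k' by simp
  ultimately show ?case using i by blast
qed

lemma lev_disjoint: "k < hgt m \<Longrightarrow> k' < hgt m \<Longrightarrow> x \<in> lev m k \<Longrightarrow> x \<in> lev m k' \<Longrightarrow> k = k'"
  using iv_disjoint by (auto simp: lev_def)

lemma lev_subset_X: "k < hgt m \<Longrightarrow> lev m k \<subseteq> X"
  by (auto simp: X_def)

lemma T_lev:
  assumes "Suc k < hgt m" "x \<in> lev m k"
  shows "T x = x + (pos m (Suc k) - pos m k)"
proof -
  have "(THE y. step x y) = x + (pos m (Suc k) - pos m k)"
  proof (rule the_equality)
    show "step x (x + (pos m (Suc k) - pos m k))" unfolding step_def using assms by blast
    fix y assume "step x y"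
    then obtain m' l where l: "Suc l < hgt m'" "x \<in> lev m' l" "y = x + (pos m' (Suc l) - pos m' l)"
      unfolding step_def by blast
    \<comment> \<open>The two stages are compared at the later one, where the point lies on a single
      level.\<close>
    define n where "n = max m m'"
    obtain k' where k': "Suc k' < hgt n" "x \<in> lev n k'" "pos n (Suc k') - pos n k' = pos m (Suc k) - pos m k"
      using lev_step_refine[OF assms, of n] by (auto simp: n_def)
    obtain l' where l': "Suc l' < hgt n" "x \<in> lev n l'" "pos n (Suc l') - pos n l' = pos m' (Suc l) - pos m' l"
      using lev_step_refine[OF l(1,2), of n] by (auto simp: n_def)
    have "k' = l'" using lev_disjoint[of k' n l' x] k' l' by simp
    then show "y = x + (pos m (Suc k) - pos m k)" using k' l' l by simp
  qed
  moreover have "x \<in> X" using assms lev_subset_X[of k m] by auto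
  ultimately show ?thesis by (simp add: T_def)
qed

lemma T_in_lev: "Suc k < hgt m \<Longrightarrow> x \<in> lev m k \<Longrightarrow> T x \<in> lev m (Suc k)"
  by (simp add: T_lev translate_lev)

lemma T_image_lev:
  assumes "Suc k < hgt m"
  shows "T ` lev m k = lev m (Suc k)"
proof (intro equalityI subsetI)
  fix y assume "y \<in> T ` lev m k"
  then show "y \<in> lev m (Suc k)" using assms T_lev translate_lev[of k m "Suc k"] by auto
next
  fix y assume y: "y \<in> lev m (Suc k)"
  then have x: "y + (pos m k - pos m (Suc k)) \<in> lev m k" using translate_lev[of "Suc k" m k] assms by simp
  have "T (y + (pos m k - pos m (Suc k))) = y" using T_lev[OF assms x] by simp
  then show "y \<in> T ` lev m k" using x by force
qed

lemma T_funpow_image_lev: "k + j < hgt m \<Longrightarrow> (T ^^ j) ` lev m k = lev m (k + j)"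
proof (induction j)
  case (Suc j)
  have "(T ^^ Suc j) ` lev m k = T ` ((T ^^ j) ` lev m k)" by (simp add: image_comp)
  then show ?case using Suc T_image_lev[of "k + j" m] by simp
qed simp

lemma lev_refine_le:
  assumes "k < hgt m" "x \<in> lev m k" "m \<le> m'"
  shows "\<exists>k'<hgt m'. x \<in> lev m' k'"
  using assms(3)
proof (induction m' rule: dec_induct)
  case (step m')
  then obtain k' where "k' < hgt m'" "x \<in> lev m' k'" by blast
  then show ?case using lev_refine[of k' m' x] column_bound by blast
qed (use assms in blast)

lemma hgt_gt_1: "2 \<le> hgt m"
proof (induction m)
  case (Suc m)
  then show ?case using hgt_ge[of m] by linarith
qed simp

lemma pos_bottom: "pos m 0 = 0"
proof (induction m)
  case (Suc m)
  then show ?case using pos_col[of 0 m 0] hgt_gt_1[of m] by (simp add: ncol_def)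
qed (simp add: pos_def)

text \<open>The final copy has no spacer above it, so the top is always the rightmost piece of the
  old top. These intervals shrink to the point 2, which none of them contains, so no point stays on
  top forever.\<close>

lemma pos_top: "pos m (hgt m - 1) = 2 - wid m"
proof (induction m)
  case (Suc m)
  let ?l = "length (bs m)"
  have eq: "coff m ?l + (hgt m - 1) = hgt (Suc m) - 1"
    using coff_last[of m] hgt_gt_1[of m] by simp
  have "real ?l * wid (Suc m) = wid m - wid (Suc m)"
    using ncol_wid_Suc[of m] unfolding ncol_def by (simp add: algebra_simps)
  then show ?case
    using pos_col[of ?l m "hgt m - 1"] hgt_gt_1[of m] Suc unfolding eq
    by (simp add: ncol_def del: hgt.simps)
qed (simp add: pos_def)

lemma wid_small: "0 < e \<Longrightarrow> \<exists>m0. \<forall>m\<ge>m0. wid m < e"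
proof -
  assume "0 < e"
  then obtain m0 where m0: "(1 / 2 :: real) ^ m0 < e" using real_arch_pow_inv[of e "1/2"] by auto
  have "wid m < e" if "m0 \<le> m" for m
    using wid_le[of m] power_decreasing[OF that, of "1/2 :: real"] m0 by linarith
  then show ?thesis by blast
qed

section \<open>Invertibility on the space\<close>

lemma X_irrational: "x \<in> X \<Longrightarrow> x \<notin> \<rat>"
  by (auto simp: X_def lev_def)

lemma X_nonneg: "x \<in> X \<Longrightarrow> 0 \<le> x"
  using iv_less by (fastforce simp: X_def lev_def)

lemma X_le: "x \<in> X \<Longrightarrow> x \<le> 4"
proof -
  assume "x \<in> X"
  then obtain m k where "k < hgt m" "x \<in> iv m k" by (auto simp: X_def lev_def)
  then show "x \<le> 4" using iv_less ext_le[of m] wid_pos[of m] by fastforce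
qed

lemma X_not_top:
  assumes "x \<in> X"
  shows "\<exists>m k. Suc k < hgt m \<and> x \<in> lev m k"
proof -
  obtain m k where k: "k < hgt m" "x \<in> lev m k" using assms by (auto simp: X_def)
  show ?thesis
  proof (rule ccontr)
    assume no: "\<not> ?thesis"
    have top: "2 - wid n \<le> x \<and> x < 2" if n: "m \<le> n" for n
    proof -
      obtain k' where k': "k' < hgt n" "x \<in> lev n k'" using lev_refine_le[OF k n] by blast
      then have "\<not> Suc k' < hgt n" using no by blast
      then have "k' = hgt n - 1" using k' by simp
      then show ?thesis using k'(2) by (simp add: lev_def iv_def pos_top[simplified])
    qed
    then have "0 < 2 - x" by auto
    then obtain m0 where "\<forall>n\<ge>m0. wid n < 2 - x" using wid_small by blast
    then have "wid (max m m0) < 2 - x" by simp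
    then show False using top[of "max m m0"] by simp
  qed
qed

text \<open>The bottom intervals shrink to 0, which all of them contain; irrationality is what
  excludes it.\<close>

lemma X_not_bottom:
  assumes "y \<in> X"
  obtains m k where "Suc k < hgt m" "y \<in> lev m (Suc k)"
proof -
  obtain m k where k: "k < hgt m" "y \<in> lev m k" using assms by (auto simp: X_def)
  have "0 < y" using X_nonneg[OF assms] X_irrational[OF assms] by (cases "y = 0") auto
  then obtain m0 where m0: "\<forall>n\<ge>m0. wid n < y" using wid_small by blast
  obtain k' where k': "k' < hgt (max m m0)" "y \<in> lev (max m m0) k'"
    using lev_refine_le[OF k, of "max m m0"] by auto
  have "k' \<noteq> 0"
  proof
    assume "k' = 0"
    then have "y < wid (max m m0)" using k'(2) by (simp add: lev_def iv_def pos_bottom)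
    moreover have "wid (max m m0) < y" using m0 by simp
    ultimately show False by simp
  qed
  then show ?thesis using k' that[of "k' - 1" "max m m0"] by simp
qed

lemma bij_betw_T_X: "bij_betw T X X"
  unfolding bij_betw_def
proof
  show "inj_on T X"
  proof
    fix x y assume xy: "x \<in> X" "y \<in> X" "T x = T y"
    obtain m k where k: "Suc k < hgt m" "x \<in> lev m k" using X_not_top[OF xy(1)] by blast
    obtain m' l where l: "Suc l < hgt m'" "y \<in> lev m' l" using X_not_top[OF xy(2)] by blast
    define n where "n = max m m'"
    obtain k' l' where n: "Suc k' < hgt n" "x \<in> lev n k'" "Suc l' < hgt n" "y \<in> lev n l'"
      using lev_step_refine[OF k, of n] lev_step_refine[OF l, of n] by (auto simp: n_def)
    have "T y \<in> lev n (Suc k')" "T y \<in> lev n (Suc l')"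
      using T_in_lev[OF n(1,2)] T_in_lev[OF n(3,4)] unfolding xy(3) .
    from lev_disjoint[OF n(1,3) this] have "k' = l'" by simp
    then show "x = y" using T_lev[OF n(1,2)] T_lev[OF n(3,4)] xy(3) by (simp only:)
  qed
  show "T ` X = X"
  proof (intro equalityI subsetI)
    fix y assume "y \<in> T ` X"
    then obtain x where x: "x \<in> X" "y = T x" by blast
    obtain m k where k: "Suc k < hgt m" "x \<in> lev m k" using X_not_top[OF x(1)] by blast
    then show "y \<in> X" using T_in_lev[OF k] lev_subset_X[of "Suc k" m] x by auto
  next
    fix y assume "y \<in> X"
    then obtain m k where k: "Suc k < hgt m" "y \<in> lev m (Suc k)" by (rule X_not_bottom)
    then have "y \<in> T ` lev m k" by (simp add: T_image_lev)
    then show "y \<in> T ` X" using lev_subset_X[of k m] k by auto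
  qed
qed

lemma T_outside: "x \<notin> X \<Longrightarrow> T x = x"
  by (simp add: T_def)

lemma bij_T: "bij T"
proof -
  have "bij_betw T (- X) (- X)"
    by (rule bij_betwI[where g = "\<lambda>x. x"]) (auto simp: T_outside)
  from bij_betw_combine[OF bij_betw_T_X this] show ?thesis by (simp add: Un_commute)
qed

end

section \<open>The measure-preserving system\<close>

context cutting_stacking
begin

text \<open>The carrier stays the whole line and the complement of \<open>X\<close> is null, so the
  topology required of a standard space is that of the reals.\<close>

definition M :: "real measure" where
  "M = uniform_measure lborel X"

definition vol :: real where
  "vol = measure lborel X"

definition tow :: "nat \<Rightarrow> real set" where
  "tow m = (\<Union>k<hgt m. lev m k)"

lemma null_Rats: "(\<rat> :: real set) \<in> null_sets lborel"
  by (intro countable_imp_null_set_lborel countable_rat)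

lemma borel_Rats [measurable]: "(\<rat> :: real set) \<in> sets borel"
  using null_Rats by auto

lemma borel_lev [measurable]: "lev m k \<in> sets borel"
  unfolding lev_def iv_def by measurable

lemma borel_X [measurable]: "X \<in> sets borel"
  unfolding X_def by measurable

lemma emeasure_lev: "emeasure lborel (lev m k) = ennreal (wid m)"
  unfolding lev_def by (subst emeasure_Diff_null_set[OF null_Rats]) (use wid_pos[of m] in \<open>auto simp: iv_def\<close>)

lemma emeasure_UN_lev:
  assumes "Y \<subseteq> {..<hgt m}"
  shows "emeasure lborel (\<Union>k\<in>Y. lev m k) = ennreal (real (card Y) * wid m)"
proof -
  have fin: "finite Y" using assms by (rule finite_subset) simp
  have "disjoint_family_on (lev m) Y"
    unfolding disjoint_family_on_def
  proof (intro ballI impI equals0I)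
    fix k l x assume "k \<in> Y" "l \<in> Y" "k \<noteq> l" "x \<in> lev m k \<inter> lev m l"
    then show False using lev_disjoint[of k m l x] assms by auto
  qed
  then have "emeasure lborel (\<Union>k\<in>Y. lev m k) = (\<Sum>k\<in>Y. emeasure lborel (lev m k))"
    using fin by (intro sum_emeasure[symmetric]) auto
  also have "\<dots> = ennreal (real (card Y) * wid m)"
    using wid_pos[of m] by (simp add: emeasure_lev ennreal_mult ennreal_of_nat_eq_real_of_nat)
  finally show ?thesis .
qed

lemma emeasure_X_le: "emeasure lborel X \<le> ennreal 4"
proof -
  have "emeasure lborel X \<le> emeasure lborel {0..4::real}"
    using X_nonneg X_le by (intro emeasure_mono) auto
  then show ?thesis by simp
qed

lemma emeasure_X: "emeasure lborel X = ennreal vol"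
  unfolding vol_def using emeasure_X_le by (intro emeasure_eq_ennreal_measure) (auto simp: top_unique)

lemma hgt_wid_le_vol: "real (hgt m) * wid m \<le> vol"
proof -
  have "ennreal (real (hgt m) * wid m) = emeasure lborel (\<Union>k\<in>{..<hgt m}. lev m k)"
    by (subst emeasure_UN_lev) auto
  also have "\<dots> \<le> emeasure lborel X" by (intro emeasure_mono) (auto simp: X_def)
  finally show ?thesis using wid_pos[of m] by (simp add: emeasure_X vol_def)
qed

lemma vol_bounds: "2 \<le> vol" "vol \<le> 4"
proof -
  show "2 \<le> vol" using hgt_wid_le_vol[of 0] by simp
  then show "vol \<le> 4" using emeasure_X_le unfolding emeasure_X by (subst (asm) ennreal_le_iff) auto
qed

lemma space_M [simp]: "space M = UNIV" and sets_M [simp]: "sets M = sets borel"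
  by (simp_all add: M_def)

lemma prob_space_M: "prob_space M"
  unfolding M_def using vol_bounds by (intro prob_space_uniform_measure) (auto simp: emeasure_X)

lemma emeasure_M: "A \<in> sets borel \<Longrightarrow> emeasure M A = emeasure lborel (X \<inter> A) / ennreal vol"
  unfolding M_def by (simp add: emeasure_X)

lemma measure_UN_lev:
  assumes "Y \<subseteq> {..<hgt m}"
  shows "measure M (\<Union>k\<in>Y. lev m k) = real (card Y) * wid m / vol"
proof -
  have "finite Y" using assms by (rule finite_subset) simp
  then have borel: "(\<Union>k\<in>Y. lev m k) \<in> sets borel" by measurable
  have "(\<Union>k\<in>Y. lev m k) \<subseteq> X" using assms lev_subset_X[of _ m] by auto
  then have "X \<inter> (\<Union>k\<in>Y. lev m k) = (\<Union>k\<in>Y. lev m k)" by (rule Int_absorb1)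
  then have "emeasure M (\<Union>k\<in>Y. lev m k) = ennreal (real (card Y) * wid m) / ennreal vol"
    using emeasure_M[OF borel] by (simp only: emeasure_UN_lev[OF assms])
  also have "\<dots> = ennreal (real (card Y) * wid m / vol)"
    using vol_bounds wid_pos[of m] by (intro divide_ennreal) auto
  finally show ?thesis using vol_bounds wid_pos[of m] by (simp add: measure_def)
qed

lemma null_outside_X: "A \<in> sets borel \<Longrightarrow> A \<inter> X = {} \<Longrightarrow> A \<in> null_sets M"
  by (intro null_setsI) (auto simp: emeasure_M Int_commute)

section \<open>Measurability and invariance of the map\<close>

lemma T_vimage:
  "T -` B = (B - X) \<union> (\<Union>m. \<Union>k\<in>{k. Suc k < hgt m}. lev m k \<inter> (\<lambda>x. x + (pos m (Suc k) - pos m k)) -` B)"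
  (is "_ = ?R")
proof (intro equalityI subsetI)
  fix x assume x: "x \<in> T -` B"
  show "x \<in> ?R"
  proof (cases "x \<in> X")
    case True
    then obtain m k where "Suc k < hgt m" "x \<in> lev m k" using X_not_top by blast
    then show ?thesis using x T_lev[of k m x] by auto
  qed (use x T_outside in auto)
next
  fix x assume "x \<in> ?R"
  then show "x \<in> T -` B" using T_outside T_lev by auto
qed

text \<open>Images under \<open>T\<close> are preimages under its inverse, so this decomposition
  into countably many translated pieces gives measurability of the inverse.\<close>

lemma T_image:
  "T ` B = (B - X) \<union> (\<Union>m. \<Union>k\<in>{k. Suc k < hgt m}. lev m (Suc k) \<inter> (\<lambda>x. x - (pos m (Suc k) - pos m k)) -` B)"
  (is "_ = ?R")
proof (intro equalityI subsetI)
  fix y assume "y \<in> T ` B"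
  then obtain x where x: "x \<in> B" "y = T x" by blast
  show "y \<in> ?R"
  proof (cases "x \<in> X")
    case True
    then obtain m k where k: "Suc k < hgt m" "x \<in> lev m k" using X_not_top by blast
    then have "y \<in> lev m (Suc k) \<inter> (\<lambda>x. x - (pos m (Suc k) - pos m k)) -` B"
      using x T_lev[OF k] T_in_lev[OF k] by simp
    then show ?thesis using k by blast
  qed (use x T_outside in auto)
next
  fix y assume "y \<in> ?R"
  then consider "y \<in> B - X" | m k where "Suc k < hgt m" "y \<in> lev m (Suc k)" "y - (pos m (Suc k) - pos m k) \<in> B"
    by auto
  then show "y \<in> T ` B"
  proof cases
    case 1
    then show ?thesis using T_outside[of y] by force
  next
    case (2 m k)
    then have "y - (pos m (Suc k) - pos m k) \<in> lev m k"
      using translate_lev[of "Suc k" m k y] by (simp add: algebra_simps)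
    then have "T (y - (pos m (Suc k) - pos m k)) = y" using T_lev 2(1) by simp
    then show ?thesis using 2(3) by (metis imageI)
  qed
qed

lemma borel_vimage_translate: "B \<in> sets borel \<Longrightarrow> (\<lambda>x::real. x + d) -` B \<in> sets borel"
  using measurable_sets[of "\<lambda>x::real. x + d" borel borel B] by simp

lemma T_measurable: "T \<in> borel_measurable borel"
proof (rule measurableI)
  fix B :: "real set" assume [measurable]: "B \<in> sets borel"
  note [measurable] = borel_vimage_translate[OF this]
  have "T -` B \<in> sets borel" unfolding T_vimage by measurable
  then show "T -` B \<inter> space borel \<in> sets borel" by simp
qed simp

lemma T_inv_measurable: "the_inv_into UNIV T \<in> borel_measurable borel"
proof (rule measurableI)
  fix B :: "real set" assume [measurable]: "B \<in> sets borel"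
  have [measurable]: "(\<lambda>x. x - d) -` B \<in> sets borel" for d :: real
    using borel_vimage_translate[of B "- d"] by simp
  have "the_inv_into UNIV T -` B = T ` B"
  proof (intro equalityI subsetI)
    fix y assume "y \<in> the_inv_into UNIV T -` B"
    then show "y \<in> T ` B"
      using f_the_inv_into_f_bij_betw[OF bij_T, of y] by (metis UNIV_I imageI vimageE)
  next
    fix y assume "y \<in> T ` B"
    then show "y \<in> the_inv_into UNIV T -` B"
      using bij_T by (auto simp: the_inv_f_f bij_is_inj)
  qed
  also have "T ` B \<in> sets borel" unfolding T_image by measurable
  finally show "the_inv_into UNIV T -` B \<inter> space borel \<in> sets borel" by simp
qed simp

lemma T_rational: "x \<in> X \<Longrightarrow> T x - x \<in> \<rat>"
proof -
  assume "x \<in> X"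
  then obtain m k where k: "Suc k < hgt m" "x \<in> lev m k" using X_not_top by blast
  then show ?thesis using T_lev[OF k] rational_pos[of k m] rational_pos[of "Suc k" m] by simp
qed

lemma distr_T: "distr M M T = M"
proof (rule measure_eqI)
  fix A assume "A \<in> sets (distr M M T)"
  then have A: "A \<in> sets borel" by simp
  have TA: "T -` A \<in> sets borel" using measurable_sets[OF T_measurable A] by simp
  have "T \<in> measurable M M"
    using T_measurable by (simp add: measurable_def)
  then have "emeasure (distr M M T) A = emeasure M (T -` A)" using A by (simp add: emeasure_distr)
  also have "\<dots> = emeasure M A"
    using emeasure_lborel_rational_translation[OF borel_X bij_betw_T_X T_measurable T_rational A]
    by (simp add: emeasure_M A TA)
  finally show "emeasure (distr M M T) A = emeasure M A" .
qed simp

lemma mp_system_M: "mp_system M T"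
proof -
  have "completely_metrizable_space (euclidean :: real topology)"
    by (rule completely_metrizable_space_euclidean)
  moreover have "second_countable (euclidean :: real topology)"
  proof -
    obtain B :: "real set set" where B: "countable B" "topological_basis B"
      using ex_countable_basis by blast
    have "\<forall>V\<in>B. open V" using topological_basis_open[OF B(2)] by blast
    moreover have "\<exists>V\<in>B. x \<in> V \<and> V \<subseteq> U" if "open U" "x \<in> U" for U x
      using that by (rule topological_basisE[OF B(2)]) blast
    ultimately show ?thesis unfolding second_countable_def using B(1) by auto
  qed
  moreover have "sets M = sigma_sets (space M) {U. openin euclidean U}"
    by (simp add: borel_def)
  ultimately have std: "standard_prob_space M"
    unfolding standard_prob_space_def using prob_space_M
    by (intro conjI exI[of _ euclidean]) simp_all
  have eq: "measurable M M = measurable borel borel"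
    by (intro measurable_cong_sets) auto
  show ?thesis unfolding mp_system_def space_M eq
    by (intro conjI std bij_T T_measurable T_inv_measurable distr_T)
qed

end

section \<open>The rank one structure\<close>

context cutting_stacking
begin

declare hgt.simps(2) [simp del]

lemma lev_Int_empty: "k < hgt m \<Longrightarrow> k' < hgt m \<Longrightarrow> k \<noteq> k' \<Longrightarrow> lev m k \<inter> lev m k' = {}"
  using lev_disjoint by (intro equals0I) (metis IntE)

lemma T_funpow_image_bottom: "j < hgt m \<Longrightarrow> (T ^^ j) ` lev m 0 = lev m j"
  using T_funpow_image_lev[of 0 j m] by simp

lemma tower_lev: "tower T (lev m 0) (hgt m) = tow m"
  unfolding tower_def tow_def by (intro SUP_cong refl T_funpow_image_bottom) simp

lemma tower_part_lev: "tower_part M T (lev m 0) (hgt m) = insert (UNIV - tow m) (lev m ` {..<hgt m})"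
proof -
  have "(\<lambda>j. (T ^^ j) ` lev m 0) ` {..<hgt m} = lev m ` {..<hgt m}"
    by (intro image_cong refl T_funpow_image_bottom) simp
  then show ?thesis unfolding tower_part_def tower_lev space_M by (rule arg_cong)
qed

lemma count_take: "i \<le> length xs \<Longrightarrow> count_list (take i xs) True = (\<Sum>k=1..i. of_bool (xs ! (k - 1)))"
proof (induction i)
  case (Suc i)
  then show ?case by (simp add: take_Suc_conv_app_nth)
qed simp

lemma hgt_power: "2 ^ Suc m \<le> hgt m"
proof (induction m)
  case (Suc m)
  then show ?case using hgt_ge[of m] by simp
qed simp

lemma tow_subset_Suc: "tow m \<subseteq> tow (Suc m)"
proof
  fix x assume "x \<in> tow m"
  then obtain k where k: "k < hgt m" "x \<in> lev m k" by (auto simp: tow_def)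
  then obtain k' where "k' < hgt (Suc m)" "x \<in> lev (Suc m) k'"
    using lev_refine_le[OF k, of "Suc m"] by auto
  then show "x \<in> tow (Suc m)" unfolding tow_def by blast
qed

text \<open>A new level is a piece of an old level or a spacer, and spacers lie to the right of the
  whole old tower.\<close>

lemma tower_part_refines:
  assumes "A \<in> tower_part M T (lev (Suc m) 0) (hgt (Suc m))"
  shows "\<exists>B\<in>tower_part M T (lev m 0) (hgt m). A \<subseteq> B"
proof -
  from assms consider "A = UNIV - tow (Suc m)" | k where "k < hgt (Suc m)" "A = lev (Suc m) k"
    by (auto simp: tower_part_lev)
  then show ?thesis
  proof cases
    case 1
    then have "A \<subseteq> UNIV - tow m" using tow_subset_Suc[of m] by auto
    then show ?thesis unfolding tower_part_lev by (intro bexI[of _ "UNIV - tow m"]) auto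
  next
    case (2 k)
    from 2(1) show ?thesis
    proof (cases rule: level_cases)
      case (column i j)
      then have "A \<subseteq> lev m j" using iv_col_subset[of i m j] 2(2) by (auto simp: lev_def)
      then show ?thesis using column unfolding tower_part_lev by (intro bexI[of _ "lev m j"]) auto
    next
      case (spacer i)
      have "A \<subseteq> UNIV - tow m"
      proof
        fix x assume "x \<in> A"
        then have "ext m \<le> x" using iv_spacer_ge[of i m x] spacer 2 by (simp add: lev_def)
        then show "x \<in> UNIV - tow m" using iv_less[of _ m x] by (force simp: tow_def lev_def)
      qed
      then show ?thesis unfolding tower_part_lev by (intro bexI[of _ "UNIV - tow m"]) auto
    qed
  qed
qed

text \<open>The intervals shrink, so an open set meets \<open>X\<close> in the countable union of
  the levels whose intervals it contains. Complements are taken inside \<open>X\<close>, which is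
  itself a union of levels.\<close>

lemma sigma_sets_levels:
  assumes A: "A \<in> sets borel"
  shows "X \<inter> A \<in> sigma_sets UNIV (\<Union>m. tower_part M T (lev m 0) (hgt m))" (is "_ \<in> sigma_sets UNIV ?G")
proof -
  interpret S: sigma_algebra UNIV "sigma_sets UNIV ?G"
    by (rule sigma_algebra_sigma_sets) auto
  have lev_in: "lev m k \<in> sigma_sets UNIV ?G" if "k < hgt m" for m k
    using that by (intro sigma_sets.Basic) (auto simp: tower_part_lev)
  have X_in: "X \<in> sigma_sets UNIV ?G"
    unfolding X_def using lev_in by (intro S.countable_UN'' S.finite_UN) auto
  have "A \<in> sigma_sets UNIV {S. open S}" using A by (simp add: borel_def)
  then show ?thesis
  proof induction
    case (Basic S)
    define I where "I = {(m, k). k < hgt m \<and> iv m k \<subseteq> S}"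
    have "X \<inter> S = (\<Union>(m, k)\<in>I. lev m k)"
    proof (intro equalityI subsetI)
      fix x assume x: "x \<in> X \<inter> S"
      then obtain e where e: "e > 0" "ball x e \<subseteq> S" using Basic openE by auto
      obtain m0 where m0: "\<forall>m\<ge>m0. wid m < e" using wid_small[OF e(1)] by blast
      obtain m k where k: "k < hgt m" "x \<in> lev m k" using x by (auto simp: X_def)
      obtain k' where k': "k' < hgt (max m m0)" "x \<in> lev (max m m0) k'"
        using lev_refine_le[OF k, of "max m m0"] by auto
      have "wid (max m m0) < e" using m0 by simp
      then have "iv (max m m0) k' \<subseteq> ball x e"
        using k'(2) by (auto simp: lev_def iv_def dist_real_def)
      then have "(max m m0, k') \<in> I" using k' e by (auto simp: I_def)
      then show "x \<in> (\<Union>(m, k)\<in>I. lev m k)" using k'(2) by blast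
    next
      fix x assume "x \<in> (\<Union>(m, k)\<in>I. lev m k)"
      then obtain m k where "k < hgt m" "iv m k \<subseteq> S" "x \<in> lev m k" by (auto simp: I_def)
      then show "x \<in> X \<inter> S" using lev_subset_X[of k m] by (auto simp: lev_def)
    qed
    also have "\<dots> \<in> sigma_sets UNIV ?G"
      using lev_in by (intro S.countable_UN'') (auto simp: I_def)
    finally show ?case .
  next
    case Empty
    then show ?case by simp
  next
    case (Compl a)
    have "X \<inter> (UNIV - a) = X - X \<inter> a" by auto
    then show ?case using S.Diff[OF X_in Compl.IH] by simp
  next
    case (Union a)
    have "X \<inter> (\<Union>i. a i) = (\<Union>i. X \<inter> a i)" by auto
    then show ?case using Union.IH by (simp only:) (intro S.countable_UN'', auto)
  qed
qed

text \<open>Stages are counted from 0, the towers of a rank one system from 1.\<close>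

abbreviation rank_one_height :: "nat \<Rightarrow> nat" where
  "rank_one_height n \<equiv> hgt (n - 1)"

lemma rank_one_params_hgt:
  "rank_one_params rank_one_height (\<lambda>n. ncol (n - 1)) (\<lambda>n i. of_bool (bs (n - 1) ! (i - 1)))"
proof -
  have hgt_Suc: "hgt (Suc m) = ncol m * hgt m + (\<Sum>i=1..length (bs m). of_bool (bs m ! (i - 1)))" for m
    using count_take[of "length (bs m)" "bs m"] by (simp add: ncol_def bs_def hgt.simps(2))
  define f where "f n = real (\<Sum>i=1..ncol (n - 1) - 1. of_bool (bs (n - 1) ! (i - 1)) :: nat) / real (hgt (Suc n - 1))" for n
  have bound: "norm (f n) \<le> 2 * (1 / 2) ^ n" if "1 \<le> n" for n
  proof -
    obtain m where m: "n = Suc m" using \<open>1 \<le> n\<close> by (cases n) auto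
    have l: "0 < length (bs m)" using bs_nonempty by simp
    define c :: nat where "c = (\<Sum>i=1..length (bs m). of_bool (bs m ! (i - 1)))"
    have "c \<le> (\<Sum>i=1..length (bs m). 1)" unfolding c_def by (intro sum_mono) auto
    then have c: "real c \<le> real (length (bs m))" by simp
    have "f n = real c / real (hgt (Suc m))" by (simp only: f_def m ncol_def c_def diff_Suc_1)
    also have "\<dots> \<le> real (length (bs m)) / real (hgt (Suc m))"
      by (rule divide_right_mono[OF c]) simp
    \<comment> \<open>There is at most one spacer per bit, while the columns have height at least
      \<open>2 ^ n\<close>. So the spacer proportions decay geometrically.\<close>
    also have "\<dots> \<le> real (length (bs m)) / real (length (bs m) * 2 ^ n)"
    proof (rule divide_left_mono)
      have "length (bs m) * 2 ^ n \<le> length (bs m) * hgt m"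
        using hgt_power[of m] unfolding m by (intro mult_left_mono) auto
      also have "\<dots> \<le> hgt (Suc m)" unfolding hgt_Suc ncol_def by simp
      finally show "real (length (bs m) * 2 ^ n) \<le> real (hgt (Suc m))" by (simp only: of_nat_le_iff)
      show "0 < real (hgt (Suc m)) * real (length (bs m) * 2 ^ n)"
        using l hgt_gt_1[of "Suc m"] by simp
    qed simp
    also have "\<dots> = (1 / 2) ^ n" using l by (simp add: power_one_over)
    finally have "f n \<le> (1 / 2) ^ n" .
    moreover have "0 \<le> f n" unfolding f_def by (intro divide_nonneg_nonneg of_nat_0_le_iff)
    moreover have "(0::real) \<le> (1 / 2) ^ n" by simp
    ultimately show ?thesis unfolding real_norm_def by linarith
  qed
  have "summable (\<lambda>n. 2 * (1 / 2 :: real) ^ n)"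
    by (intro summable_mult summable_geometric) simp
  then have "summable (\<lambda>n. norm (f n))"
    by (rule summable_comparison_test'[where N = 1]) (use bound in simp)
  from norm_summable_imp_summable_on[OF this] have sum: "f summable_on {1..}"
    by (rule summable_on_subset_banach) simp
  have mono: "strict_mono_on {1..} rank_one_height"
  proof (rule strict_mono_onI)
    have "hgt m < hgt (Suc m)" for m using hgt_ge[of m] hgt_gt_1[of m] by linarith
    then have mono: "strict_mono hgt" by (simp add: strict_mono_Suc_iff)
    show "hgt (r - 1) < hgt (s - 1)" if "r \<in> {1..}" "s \<in> {1..}" "r < s" for r s :: nat
      using that by (intro strict_monoD[OF mono]) auto
  qed
  have rec: "hgt (Suc n - 1) = ncol (n - 1) * hgt (n - 1) +
      (\<Sum>i=1..ncol (n - 1) - 1. of_bool (bs (n - 1) ! (i - 1)))" if "n \<ge> 1" for n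
    using hgt_Suc[of "n - 1"] that by (simp add: ncol_def)
  show ?thesis
    unfolding rank_one_params_def
  proof (intro conjI allI impI)
    show "1 \<le> hgt (1 - 1)" by simp
    show "1 \<le> ncol (n - 1)" for n by (simp add: ncol_def)
  qed (fact rec mono sum[unfolded f_def[abs_def]])+
qed

lemma rank_one_system_M: "rank_one_system M T rank_one_height"
proof -
  let ?q = "\<lambda>n. ncol (n - 1)" and ?a = "\<lambda>n i. of_bool (bs (n - 1) ! (i - 1)) :: nat"
  \<comment> \<open>Column piece \<open>i\<close> is a level of the next stage, the one at which
    copy \<open>i\<close> starts. With these choices the relations among bases and columns hold
    exactly.\<close>
  let ?F = "\<lambda>n. lev (n - 1) 0" and ?C = "\<lambda>n i. lev n (coff (n - 1) (i - 1))"
  have null_empty: "{} \<in> null_sets M" by simp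
  have towers: "rank_one_towers M T rank_one_height ?q ?a ?F ?C"
    unfolding rank_one_towers_def
  proof (intro conjI allI impI ballI)
    fix n :: nat assume n: "1 \<le> n"
    then obtain m where m: "n = Suc m" by (cases n) auto
    show "?F n \<in> sets M" by simp
    show "0 < measure M (?F n)"
      using measure_UN_lev[of "{0}" "n - 1"] hgt_gt_1[of "n - 1"] wid_pos vol_bounds by simp
    show "disjoint_mod M ((T ^^ j) ` ?F n) ((T ^^ k) ` ?F n)"
      if "j < hgt (n - 1)" "k < hgt (n - 1)" "j \<noteq> k" for j k
    proof -
      have "(T ^^ j) ` ?F n \<inter> (T ^^ k) ` ?F n = lev (n - 1) j \<inter> lev (n - 1) k"
        using T_funpow_image_lev[of 0 j "n - 1"] T_funpow_image_lev[of 0 k "n - 1"] that by simp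
      also have "\<dots> = {}" using that by (rule lev_Int_empty)
      finally show ?thesis using null_empty by (simp add: disjoint_mod_def)
    qed
    show "?C n i \<in> sets M" for i by simp
    have col: "coff m (i - 1) < hgt (Suc m)" if "i \<in> {1..ncol m}" for i
      using column_bound[of "i - 1" m 0] that hgt_gt_1[of m] by auto
    show "disjoint_mod M (?C n i) (?C n k)"
      if "i \<in> {1..?q n}" "k \<in> {1..?q n}" "i \<noteq> k" for i k
    proof -
      have "coff m (i - 1) \<noteq> coff m (k - 1)"
      proof
        assume eq: "coff m (i - 1) = coff m (k - 1)"
        have "i - 1 < ncol m" "k - 1 < ncol m" using that m by auto
        then have "i - 1 = k - 1" using coff_add_inject[of m "i - 1" 0 "k - 1" 0] eq hgt_gt_1[of m] by simp
        then show False using that by auto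
      qed
      then have "lev (Suc m) (coff m (i - 1)) \<inter> lev (Suc m) (coff m (k - 1)) = {}"
        using that m by (intro lev_Int_empty col) simp_all
      then have "?C n i \<inter> ?C n k = {}" by (simp add: m)
      then show ?thesis using null_empty by (simp add: disjoint_mod_def)
    qed
    have F_eq: "?F n = (\<Union>i\<in>{1..?q n}. ?C n i)"
    proof (intro equalityI subsetI)
      fix x assume "x \<in> ?F n"
      then obtain i where "i < ncol m" "x \<in> lev (Suc m) (coff m i + 0)"
        using lev_refine[of 0 m x] hgt_gt_1[of m] m by auto
      then show "x \<in> (\<Union>i\<in>{1..?q n}. ?C n i)" using m by (intro UN_I[of "Suc i"]) simp_all
    next
      fix x assume "x \<in> (\<Union>i\<in>{1..?q n}. ?C n i)"
      then obtain i where i: "i \<in> {1..ncol m}" "x \<in> lev (Suc m) (coff m (i - 1) + 0)" using m by auto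
      then have "i - 1 < ncol m" by auto
      from iv_col_subset[OF this, of 0] have "lev (Suc m) (coff m (i - 1) + 0) \<subseteq> lev m 0"
        using hgt_gt_1[of m] by (auto simp: lev_def)
      then show "x \<in> ?F n" using i m by auto
    qed
    show "eq_mod M (?F n) (\<Union>i\<in>{1..?q n}. ?C n i)"
      unfolding F_eq[symmetric] using null_empty by (simp add: eq_mod_def)
    show "eq_mod M ((T ^^ (hgt (n - 1) + ?a n i)) ` ?C n i) (?C n (Suc i))" if "i \<in> {1..?q n - 1}" for i
    proof -
      have i: "i - 1 < length (bs m)" "Suc (i - 1) = i" "i < ncol m" using that m by (auto simp: ncol_def)
      have eq: "coff m (i - 1) + (hgt m + ?a n i) = coff m i"
        using coff_Suc[OF i(1)] i(2) m by simp
      have "coff m i < hgt (Suc m)" using column_bound[OF i(3), of 0] hgt_gt_1[of m] by simp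
      then have "(T ^^ (hgt m + ?a n i)) ` lev (Suc m) (coff m (i - 1)) = lev (Suc m) (coff m i)"
        using T_funpow_image_lev[of "coff m (i - 1)" "hgt m + ?a n i" "Suc m"] unfolding eq by simp
      then show ?thesis using null_empty m by (simp add: eq_mod_def)
    qed
    show "eq_mod M (?F (Suc n)) (?C n 1)" using null_empty by (simp add: eq_mod_def)
    fix A assume "A \<in> tower_part M T (?F (Suc n)) (hgt (Suc n - 1))"
    then obtain B where B: "B \<in> tower_part M T (lev m 0) (hgt m)" "A \<subseteq> B"
      using tower_part_refines[of A m] m by auto
    have empty: "A - B = {}" using B(2) by blast
    have "subset_mod M A B" unfolding subset_mod_def empty by (rule null_empty)
    then show "\<exists>B\<in>tower_part M T (?F n) (hgt (n - 1)). subset_mod M A B"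
      using m B(1) by (intro bexI[of _ B]) simp_all
  next
    fix A assume "A \<in> sets M"
    then have A: "A \<in> sets borel" by simp
    define g where "g m = tower_part M T (lev m 0) (hgt m)" for m
    have "range g \<subseteq> (\<lambda>n. g (n - 1)) ` {1..}"
    proof
      fix S assume "S \<in> range g"
      then obtain m where "S = g (Suc m - 1)" by auto
      then show "S \<in> (\<lambda>n. g (n - 1)) ` {1..}" by (rule image_eqI) simp
    qed
    then have "(\<lambda>n. g (n - 1)) ` {1..} = range g" by auto
    then have "X \<inter> A \<in> sigma_sets (space M) (\<Union>n\<in>{1..}. tower_part M T (?F n) (hgt (n - 1)))"
      using sigma_sets_levels[OF A] by (simp add: g_def)
    moreover have "eq_mod M A (X \<inter> A)"
      unfolding eq_mod_def using A by (intro null_outside_X) auto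
    ultimately show "\<exists>B\<in>sigma_sets (space M) (\<Union>n\<in>{1..}. tower_part M T (?F n) (hgt (n - 1))). eq_mod M A B"
      by blast
  qed
  show ?thesis
    unfolding rank_one_system_def
    by (intro conjI exI[of _ ?q] exI[of _ ?a] exI[of _ ?F] exI[of _ ?C] mp_system_M
        rank_one_params_hgt towers)
qed

end

section \<open>Tower words\<close>

lemma finite_mpart_common_refinement:
  assumes "finite \<P>" "\<P> \<noteq> {}" and P: "\<And>P. P \<in> \<P> \<Longrightarrow> finite_mpart M P"
  shows "finite_mpart M (common_refinement \<P>)"
  unfolding finite_mpart_def
proof (intro conjI)
  show "finite (common_refinement \<P>)"
    unfolding common_refinement_def using assms
    by (intro finite_Diff finite_UN_I finite_PiE) (auto simp: finite_mpart_def)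
  show "common_refinement \<P> \<subseteq> sets M"
  proof
    fix A assume "A \<in> common_refinement \<P>"
    then obtain f where f: "f \<in> (\<Pi>\<^sub>E P\<in>\<P>. P)" "A = \<Inter> (f ` \<P>)"
      unfolding common_refinement_def by blast
    have "f P \<in> sets M" if "P \<in> \<P>" for P
      using f(1) P[OF that] that by (auto simp: finite_mpart_def PiE_iff)
    then show "A \<in> sets M" unfolding f(2) using assms by (intro sets.finite_INT) auto
  qed
  show "partition_on (space M) (common_refinement \<P>)"
    using assms by (intro partition_on_common_refinement) (auto simp: finite_mpart_def)
qed

text \<open>The letters stand for the two levels of the initial tower and for everything else.
  Spacers of all stages lie at 2 or beyond, so one partition serves every stage.\<close>

definition symb :: "real \<Rightarrow> nat" where
  "symb x = (if 0 \<le> x \<and> x < 1 then 0 else if 1 \<le> x \<and> x < 2 then 1 else 2)"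

definition symb_part :: "real set set" where
  "symb_part = (\<lambda>i. symb -` {i}) ` {..2}"

lemma borel_vimage_symb: "symb -` {i} \<in> sets borel"
proof -
  have "symb \<in> measurable borel (count_space UNIV)" unfolding symb_def[abs_def] by measurable
  from measurable_sets[OF this, of "{i}"] show ?thesis by simp
qed

lemma partition_on_symb_part: "partition_on UNIV symb_part"
proof (rule partition_onI)
  have "symb x \<le> 2" for x by (simp add: symb_def)
  then show "\<Union> symb_part = UNIV" by (auto simp: symb_part_def)
  show "disjnt p q" if "p \<in> symb_part" "q \<in> symb_part" "p \<noteq> q" for p q
    using that by (auto simp: symb_part_def disjnt_def)
  have "symb 0 = 0" "symb 1 = 1" "symb 2 = 2" by (simp_all add: symb_def)
  then have "\<exists>x. symb x = i" if "i \<le> 2" for i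
  proof -
    have "i = 0 \<or> i = 1 \<or> i = 2" using that by linarith
    then show ?thesis using \<open>symb 0 = 0\<close> \<open>symb 1 = 1\<close> \<open>symb 2 = 2\<close> by blast
  qed
  then show "{} \<notin> symb_part" by (fastforce simp: symb_part_def)
qed

context cutting_stacking
begin

definition word :: "nat \<Rightarrow> nat list" where
  "word m = map symb (levs m)"

lemma length_word [simp]: "length (word m) = hgt m"
  by (simp add: word_def length_levs)


lemma word_nth: "k < hgt m \<Longrightarrow> word m ! k = symb (pos m k)"
  by (simp add: word_def pos_def length_levs)

text \<open>Stated for \<open>iv\<close> and not for \<open>lev\<close>: \<open>word\<close> reads
  its letters at left endpoints, which are rational and so missing from \<open>lev\<close>.\<close>

lemma symb_lev: "k < hgt m \<Longrightarrow> x \<in> iv m k \<Longrightarrow> symb x = word m ! k"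
proof (induction m arbitrary: k x)
  case 0
  then show ?case by (auto simp: word_def iv_def pos_def symb_def less_2_cases_iff)
next
  case (Suc m)
  have p: "pos (Suc m) k \<in> iv (Suc m) k" using wid_pos[of "Suc m"] by (simp add: iv_def)
  have w: "word (Suc m) ! k = symb (pos (Suc m) k)"
    using Suc.prems(1) by (rule word_nth)
  from Suc.prems(1) show ?case
  proof (cases rule: level_cases)
    case (column i j)
    then have "x \<in> iv m j" "pos (Suc m) k \<in> iv m j" using iv_col_subset Suc.prems(2) p by blast+
    then have "symb x = word m ! j" "symb (pos (Suc m) k) = word m ! j"
      using column(2) by (auto intro: Suc.IH)
    then show ?thesis using w by simp
  next
    case (spacer i)
    then have "2 \<le> x" "2 \<le> pos (Suc m) k"
      using iv_spacer_ge[OF spacer(1,2)] ext_ge[of m] Suc.prems(2) p by (auto intro: order_trans)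
    then show ?thesis using w by (simp add: symb_def)
  qed
qed

lemma symb_T_funpow:
  assumes "x \<in> lev m y" "y + s < hgt m"
  shows "symb ((T ^^ s) x) = word m ! (y + s)"
proof -
  have "(T ^^ s) x \<in> (T ^^ s) ` lev m y" using assms(1) by (rule imageI)
  then have "(T ^^ s) x \<in> lev m (y + s)" unfolding T_funpow_image_lev[OF assms(2)] .
  then show ?thesis using symb_lev[OF assms(2)] by (simp add: lev_def)
qed

lemma coff_length_blocks: "i \<le> length (bs m) \<Longrightarrow> coff m i = length (blocks (word m) 2 (take i (bs m)))"
  by (simp add: coff_def length_blocks)

lemma word_Suc: "word (Suc m) = blocks (word m) 2 (bs m) @ word m"
proof (rule nth_equalityI)
  have l: "length (blocks (word m) 2 (bs m)) = coff m (length (bs m))"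
    by (simp add: coff_length_blocks)
  show "length (word (Suc m)) = length (blocks (word m) 2 (bs m) @ word m)"
    using coff_last[of m] by (simp add: l)
  fix k assume "k < length (word (Suc m))"
  then have k: "k < hgt (Suc m)" by simp
  have p: "pos (Suc m) k \<in> iv (Suc m) k" using wid_pos[of "Suc m"] by (simp add: iv_def)
  have w: "word (Suc m) ! k = symb (pos (Suc m) k)"
    using k by (rule word_nth)
  have split: "blocks (word m) 2 (bs m) = blocks (word m) 2 (take i (bs m)) @
      word m @ (if bs m ! i then [2] else []) @ blocks (word m) 2 (drop (Suc i) (bs m))"
    if "i < length (bs m)" for i
  proof -
    have "bs m = take i (bs m) @ bs m ! i # drop (Suc i) (bs m)" using that by (rule id_take_nth_drop)
    then have "blocks (word m) 2 (bs m) = blocks (word m) 2 (take i (bs m) @ bs m ! i # drop (Suc i) (bs m))"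
      by simp
    then show ?thesis by (simp only: blocks_simps)
  qed
  from k show "word (Suc m) ! k = (blocks (word m) 2 (bs m) @ word m) ! k"
  proof (cases rule: level_cases)
    case (column i j)
    have "symb (pos (Suc m) k) = word m ! j"
      using column iv_col_subset[of i m j] p by (intro symb_lev) auto
    moreover have "(blocks (word m) 2 (bs m) @ word m) ! k = word m ! j"
    proof (cases "i < length (bs m)")
      case True
      then have "length (blocks (word m) 2 (take i (bs m))) = coff m i" by (simp add: coff_length_blocks)
      then show ?thesis unfolding split[OF True] column(3) using column(2) by (simp add: nth_append)
    next
      case False
      then have "i = length (bs m)" using column(1) by (simp add: ncol_def)
      then show ?thesis using column(3) l by (simp add: nth_append)
    qed
    ultimately show ?thesis using w by simp
  next
    case (spacer i)
    then have "2 \<le> pos (Suc m) k"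
      using iv_spacer_ge[OF spacer(1,2)] ext_ge[of m] p by (auto intro: order_trans)
    then have "symb (pos (Suc m) k) = 2" by (simp add: symb_def)
    moreover have "length (blocks (word m) 2 (take i (bs m))) = coff m i"
      using spacer by (simp add: coff_length_blocks)
    then have "(blocks (word m) 2 (bs m) @ word m) ! k = 2"
      unfolding split[OF spacer(1)] spacer(3) using spacer(2) by (simp add: nth_append)
    ultimately show ?thesis using w by simp
  qed
qed

lemma word_0: "word 0 = [0, 1]"
  by (simp add: word_def symb_def)

lemma blocks_hd: "cs \<noteq> [] \<Longrightarrow> B \<noteq> [] \<Longrightarrow> hd (blocks B s cs) = hd B"
  by (cases cs) auto

lemma blocks_last: "cs \<noteq> [] \<Longrightarrow> B \<noteq> [] \<Longrightarrow> last (blocks B s cs) \<in> {last B, s}"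
  by (cases cs rule: rev_cases) auto

text \<open>Each stage begins and ends with a full copy of the previous word, so the end letters
  persist. The blocks before the final copy end in \<open>1\<close> or \<open>2\<close>, never in
  the \<open>0\<close> that follows.\<close>

lemma word_adj: "distinct_adj (word m) \<and> hd (word m) = 0 \<and> last (word m) = 1"
proof (induction m)
  case (Suc m)
  have ne: "word m \<noteq> []" using hgt_gt_1[of m] by (auto simp flip: length_greater_0_conv)
  have l: "last (blocks (word m) 2 (bs m)) \<noteq> 0"
    using blocks_last[OF bs_nonempty[of m] ne, of 2] Suc by auto
  have "distinct_adj (2 # blocks (word m) 2 (bs m))"
    using Suc ne by (intro distinct_adj_Cons_blocks) auto
  then have "distinct_adj (blocks (word m) 2 (bs m))" by (rule distinct_adj_ConsD)
  then have "distinct_adj (word (Suc m))"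
    unfolding word_Suc distinct_adj_append_iff using Suc l by auto
  moreover have "blocks (word m) 2 (bs m) \<noteq> []"
    using bs_nonempty[of m] ne by (cases "bs m") auto
  then have "hd (word (Suc m)) = 0"
    unfolding word_Suc using bs_nonempty[of m] ne Suc by (simp add: blocks_hd)
  ultimately show ?case using Suc ne by (simp add: word_Suc)
qed (simp add: word_0)

lemma word_props:
  "distinct_adj (word m)" "word m \<noteq> []" "hd (word m) \<noteq> 2" "last (word m) \<noteq> 2"
  "hd (word m) \<noteq> last (word m)"
  using word_adj[of m] hgt_gt_1[of m] by (auto simp flip: length_greater_0_conv)

text \<open>Every bit contributes at least a full copy, so the bits of \<open>u\<close> fix at least
  \<open>length u * hgt m\<close> letters, whatever \<open>v\<close> is.\<close>

lemma word_Suc_nth: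
  assumes "i \<le> length (bs m)" "drop i (bs m) = u @ v" "z < length u * hgt m"
  shows "word (Suc m) ! (coff m i + z) = blocks (word m) 2 u ! z"
proof -
  have "bs m = take i (bs m) @ u @ v" using assms(2) by (metis append_take_drop_id)
  then have "word (Suc m) = blocks (word m) 2 (take i (bs m) @ u @ v) @ word m"
    using word_Suc[of m] by simp
  moreover have "z < length (blocks (word m) 2 u)" using assms(3) by (simp add: length_blocks)
  ultimately show ?thesis using assms(1) by (simp add: coff_length_blocks nth_append)
qed

end

section \<open>Entropy along a window of times\<close>

context cutting_stacking
begin

text \<open>Cutting keeps the total length of a tower and spacers only add to it; it starts at
  2.\<close>

lemma hgt_wid_mono: "2 \<le> real (hgt m) * wid m"
proof (induction m)
  case (Suc m)
  have "real (hgt m) * wid m = real (ncol m * hgt m) * wid (Suc m)"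
    using ncol_wid_Suc[of m] by (simp add: mult.commute mult.left_commute)
  also have "\<dots> \<le> real (hgt (Suc m)) * wid (Suc m)"
    using wid_pos[of "Suc m"]
    by (intro mult_right_mono) (simp_all only: of_nat_le_iff less_imp_le, simp add: ncol_def bs_def hgt.simps(2))
  finally show ?case using Suc by linarith
qed simp

lemma bij_funpow_T: "bij (T ^^ j)"
  using bij_T by (rule bij_betw_funpow)

lemma T_funpow_measurable: "T ^^ j \<in> borel_measurable borel"
proof (induction j)
  case 0
  then show ?case by (simp add: id_def)
next
  case (Suc j)
  have "T ^^ Suc j = T \<circ> T ^^ j" by simp
  then show ?case using measurable_comp[OF Suc T_measurable] by (simp only:)
qed

lemma emeasure_T_vimage: "S \<in> sets borel \<Longrightarrow> emeasure M (T -` S) = emeasure M S"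
proof -
  assume S: "S \<in> sets borel"
  have "T \<in> measurable M M" using mp_system_M by (simp add: mp_system_def)
  then have "emeasure (distr M M T) S = emeasure M (T -` S)" using S by (simp add: emeasure_distr)
  then show ?thesis using distr_T by simp
qed

lemma measure_T_funpow_vimage: "S \<in> sets borel \<Longrightarrow> measure M ((T ^^ j) -` S) = measure M S"
proof (induction j arbitrary: S)
  case (Suc j)
  have TS: "T -` S \<in> sets borel" using measurable_sets[OF T_measurable Suc.prems] by simp
  have "(T ^^ Suc j) -` S = (T ^^ j) -` (T -` S)" by (auto simp: vimage_def)
  then have "measure M ((T ^^ Suc j) -` S) = measure M (T -` S)" using Suc.IH[OF TS] by (simp only:)
  then show ?case using emeasure_T_vimage[OF Suc.prems] by (simp only: measure_def)
qed simp

lemma finite_mpart_pullback: "finite_mpart M (pullback_part M T j symb_part)"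
proof -
  let ?P = "pullback_part M T j symb_part"
  have P: "?P = (\<lambda>A. (T ^^ j) -` A) ` symb_part" by (simp add: pullback_part_def)
  \<comment> \<open>Surjectivity keeps the pulled back sets nonempty, as an exact partition
    requires.\<close>
  have surj: "surj (T ^^ j)" using bij_funpow_T by (rule bij_is_surj)
  have "partition_on UNIV ?P"
  proof (rule partition_onI)
    have "\<Union> ?P = (T ^^ j) -` (\<Union> symb_part)" unfolding P vimage_Union by (rule refl)
    then show "\<Union> ?P = UNIV" using partition_onD1[OF partition_on_symb_part] by simp
    show "disjnt p q" if pq: "p \<in> ?P" "q \<in> ?P" "p \<noteq> q" for p q
    proof -
      obtain A B where AB: "A \<in> symb_part" "B \<in> symb_part" "p = (T ^^ j) -` A" "q = (T ^^ j) -` B"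
        using pq(1,2) unfolding P by (elim imageE)
      then have "A \<noteq> B" using pq(3) by auto
      then have empty: "A \<inter> B = {}"
        by (rule disjointD[OF partition_onD2[OF partition_on_symb_part] AB(1,2)])
      show ?thesis unfolding AB(3,4) disjnt_def vimage_Int[symmetric] empty by (rule vimage_empty)
    qed
    show "{} \<notin> ?P"
    proof
      assume "{} \<in> ?P"
      then have "{} \<in> (\<lambda>A. (T ^^ j) -` A) ` symb_part" by (simp only: P)
      then obtain A where A: "{} = (T ^^ j) -` A" "A \<in> symb_part" by (rule imageE)
      have "A = (T ^^ j) ` {}" unfolding A(1) by (rule surj_image_vimage_eq[OF surj, symmetric])
      then have "{} \<in> symb_part" using A(2) by (simp only: image_empty)
      then show False using partition_onD3[OF partition_on_symb_part] by contradiction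
    qed
  qed
  moreover have "?P \<subseteq> sets M"
  proof
    fix p assume "p \<in> ?P"
    then obtain i where i: "p = (T ^^ j) -` (symb -` {i})"
      unfolding P unfolding symb_part_def image_image by (rule imageE)
    show "p \<in> sets M"
      using measurable_sets[OF T_funpow_measurable borel_vimage_symb, of j i] unfolding i by simp
  qed
  moreover have "finite ?P" unfolding P unfolding symb_part_def by simp
  ultimately show ?thesis by (simp add: finite_mpart_def)
qed

lemma finite_mpart_symb_part: "finite_mpart M symb_part"
  using finite_mpart_pullback[of 0] by (simp add: pullback_part_def)

text \<open>
  The triple \<open>(i, p, V)\<close> stands for place \<open>p\<close> in the copy of the lower tower that precedes bit \<open>i\<close> of
  the \<open>V\<close>-th bit word. As \<open>i < D\<close>, at least \<open>D\<close> bits of that word are still to come.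
\<close>

definition good :: "nat \<Rightarrow> nat \<Rightarrow> (nat \<times> nat \<times> nat) set" where
  "good m D = {..<D} \<times> {..<hgt m} \<times> {..<2 ^ (2 * D)}"

definition good_level :: "nat \<Rightarrow> nat \<Rightarrow> nat \<times> nat \<times> nat \<Rightarrow> nat" where
  "good_level m D = (\<lambda>(i, p, V). coff m (V * (2 * D) + i) + p)"

definition good_set :: "nat \<Rightarrow> nat \<Rightarrow> real set" where
  "good_set m D = (\<Union>k\<in>good_level m D ` good m D. lev (Suc m) k)"

lemma block_index_inject:
  assumes "V * l + i = V' * l + i'" "i < l" "i' < (l::nat)"
  shows "V = V' \<and> i = i'"
proof -
  have "(V * l + i) div l = V" "(V' * l + i') div l = V'" using assms(2,3) by auto
  then have "V = V'" using assms(1) by simp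
  then show ?thesis using assms(1) by simp
qed

lemma block_index_less:
  assumes "V < 2 ^ l" "i < (l::nat)"
  shows "V * l + i < 2 ^ l * l"
proof -
  have "V * l + i < (V + 1) * l" using assms(2) by simp
  also have "\<dots> \<le> 2 ^ l * l" using assms(1) by (intro mult_right_mono) auto
  finally show ?thesis .
qed

context
  fixes m D :: nat
  assumes bs_m: "bs m = concat (all_words (2 * D))" and D: "1 \<le> D"
begin

lemma ncol_m: "ncol m = 2 ^ (2 * D) * (2 * D) + 1"
  using all_words(4)[of "2 * D"] by (simp add: ncol_def bs_m)

lemma good_column: "(i, p, V) \<in> good m D \<Longrightarrow> V * (2 * D) + i < length (bs m)"
  using block_index_less[of V "2 * D" i] ncol_m by (auto simp: good_def ncol_def)

lemma good_level_less: "g \<in> good m D \<Longrightarrow> good_level m D g < hgt (Suc m)"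
proof -
  assume g: "g \<in> good m D"
  obtain i p V where [simp]: "g = (i, p, V)" by (cases g) auto
  have "V * (2 * D) + i < ncol m" "p < hgt m"
    using good_column[of i p V] g by (auto simp: ncol_def good_def)
  from column_bound[OF this] show ?thesis by (simp add: good_level_def)
qed

lemma inj_on_good_level: "inj_on (good_level m D) (good m D)"
proof
  fix g g' assume g: "g \<in> good m D" "g' \<in> good m D" "good_level m D g = good_level m D g'"
  obtain i p V where e: "g = (i, p, V)" by (cases g) auto
  obtain i' p' V' where e': "g' = (i', p', V')" by (cases g') auto
  have *: "V * (2 * D) + i < ncol m" "p < hgt m" "V' * (2 * D) + i' < ncol m" "p' < hgt m"
    "i < 2 * D" "i' < 2 * D"
    using good_column[of i p V] good_column[of i' p' V'] g e e' by (auto simp: ncol_def good_def)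
  have "V * (2 * D) + i = V' * (2 * D) + i' \<and> p = p'"
    using coff_add_inject[of m _ p _ p'] * g(3) by (simp add: good_level_def e e')
  moreover from this have "V = V' \<and> i = i'" using block_index_inject * by blast
  ultimately show "g = g'" by (simp add: e e')
qed

lemma measure_levels_image:
  assumes "Y \<subseteq> good m D"
  shows "measure M (\<Union>k\<in>good_level m D ` Y. lev (Suc m) k) = real (card Y) * wid (Suc m) / vol"
proof -
  have "good_level m D ` Y \<subseteq> {..<hgt (Suc m)}" using assms good_level_less by auto
  moreover have "card (good_level m D ` Y) = card Y"
    using inj_on_subset[OF inj_on_good_level assms] by (rule card_image)
  ultimately show ?thesis using measure_UN_lev[of "good_level m D ` Y" "Suc m"] by simp
qed

lemma card_good: "card (good m D) = D * hgt m * 2 ^ (2 * D)"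
  by (simp add: good_def card_cartesian_product)

text \<open>Of the \<open>2 * D * 2 ^ (2 * D) + 1\<close> columns, \<open>D * 2 ^ (2 * D)\<close>
  are good, at least a third. The tower has length at least 2 in a space of volume at most
  4.\<close>

lemma measure_good_set: "1 / 6 \<le> measure M (good_set m D)"
proof -
  have "ncol m \<le> 3 * (D * 2 ^ (2 * D))"
    using D ncol_m by (simp add: algebra_simps)
  then have "real (ncol m) \<le> real (3 * (D * 2 ^ (2 * D)))" by (simp only: of_nat_le_iff)
  then have "real (ncol m) * (real (hgt m) * wid (Suc m)) \<le>
      real (3 * (D * 2 ^ (2 * D))) * (real (hgt m) * wid (Suc m))"
    using wid_pos[of "Suc m"] by (intro mult_right_mono) auto
  also have "\<dots> = 3 * (real (card (good m D)) * wid (Suc m))" by (simp add: card_good)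
  also have "real (ncol m) * (real (hgt m) * wid (Suc m)) = real (hgt m) * wid m"
    using ncol_wid_Suc[of m] by (simp add: mult.left_commute)
  finally have "2 / 3 \<le> real (card (good m D)) * wid (Suc m)" using hgt_wid_mono[of m] by simp
  then have "(2 / 3) / 4 \<le> real (card (good m D)) * wid (Suc m) / vol"
    using vol_bounds by (intro frac_le) auto
  also have "\<dots> = measure M (good_set m D)"
    unfolding good_set_def by (rule measure_levels_image[symmetric]) simp
  finally show ?thesis by simp
qed

context
  fixes s :: "nat \<Rightarrow> nat" and K :: nat
  assumes gap: "\<And>k. k < K \<Longrightarrow> s k + hgt m + 1 \<le> s (Suc k)"
    and fit: "s K + hgt m \<le> D * hgt m"
begin

text \<open>Phrased through a single bit word rather than the tower word, so that the count over
  words applies once \<open>i\<close> and \<open>p\<close> are fixed.\<close>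

definition named :: "(nat \<Rightarrow> nat) \<Rightarrow> (nat \<times> nat \<times> nat) set" where
  "named c = {(i, p, V) \<in> good m D. \<forall>k\<le>K.
     blocks (word m) 2 (drop i (all_words (2 * D) ! V)) ! (p + s k) = c k}"

lemma card_named: "card (named c) * 2 ^ K \<le> card (good m D)"
proof -
  let ?l = "2 * D"
  define Z where "Z = (\<lambda>(i, p). {V. V < 2 ^ ?l \<and> (\<forall>k\<le>K.
     blocks (word m) 2 (drop i (all_words ?l ! V)) ! (p + s k) = c k)})"
  have Z: "card (Z (i, p)) * 2 ^ K \<le> 2 ^ ?l" if "i < D" "p < hgt m" for i p
  proof -
    let ?E = "{v. length v = ?l \<and> (\<forall>k\<le>K. blocks (word m) 2 (drop i v) ! (p + s k) = c k)}"
    have "card (Z (i, p)) \<le> card ?E"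
    proof (rule card_inj_on_le)
      show "inj_on ((!) (all_words ?l)) (Z (i, p))"
        using all_words by (intro inj_on_nth) (auto simp: Z_def)
      show "(!) (all_words ?l) ` Z (i, p) \<subseteq> ?E"
      proof
        fix v assume "v \<in> (!) (all_words ?l) ` Z (i, p)"
        then obtain V where V: "V \<in> Z (i, p)" "v = all_words ?l ! V" by blast
        then have "v \<in> set (all_words ?l)" using all_words(3)[of ?l] by (simp add: Z_def)
        then show "v \<in> ?E" using V unfolding all_words(1) by (simp add: Z_def)
      qed
      show "finite ?E"
        by (rule finite_subset[OF _ finite_lists_length_eq[of "UNIV :: bool set" ?l]]) auto
    qed
    also have "card ?E * 2 ^ K \<le> 2 ^ ?l"
    proof (rule card_bits_with_name_drop[OF word_props])
      \<comment> \<open>The extra \<open>hgt m\<close> in the hypothesis on \<open>s K\<close>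
        absorbs the starting place \<open>p\<close>, and \<open>i < D\<close> leaves more than
        \<open>D\<close> bits.\<close>
      have "p + s K < D * hgt m" using fit that by simp
      also have "\<dots> \<le> (?l - i) * hgt m" using that by (intro mult_right_mono) auto
      finally show "p + s K < (?l - i) * length (word m)" by simp
    qed (use gap that in auto)
    finally show ?thesis by simp
  qed
  have "named c = (\<Union>ip\<in>{..<D} \<times> {..<hgt m}. (\<lambda>V. (fst ip, snd ip, V)) ` Z ip)"
    by (auto simp: named_def good_def Z_def)
  then have "card (named c) \<le> (\<Sum>ip\<in>{..<D} \<times> {..<hgt m}. card ((\<lambda>V. (fst ip, snd ip, V)) ` Z ip))"
    using card_UN_le[of "{..<D} \<times> {..<hgt m}" "\<lambda>ip. (\<lambda>V. (fst ip, snd ip, V)) ` Z ip"] by simp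
  also have "\<dots> \<le> (\<Sum>ip\<in>{..<D} \<times> {..<hgt m}. card (Z ip))"
  proof (rule sum_mono)
    fix ip
    have "finite (Z ip)" by (rule finite_subset[of _ "{..<2 ^ ?l}"]) (auto simp: Z_def split: prod.splits)
    then show "card ((\<lambda>V. (fst ip, snd ip, V)) ` Z ip) \<le> card (Z ip)" by (rule card_image_le)
  qed
  finally have "card (named c) * 2 ^ K \<le> (\<Sum>ip\<in>{..<D} \<times> {..<hgt m}. card (Z ip)) * 2 ^ K" by simp
  also have "\<dots> = (\<Sum>ip\<in>{..<D} \<times> {..<hgt m}. card (Z ip) * 2 ^ K)" by (rule sum_distrib_right)
  also have "\<dots> \<le> (\<Sum>ip\<in>{..<D} \<times> {..<hgt m}. 2 ^ ?l)" using Z by (intro sum_mono) auto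
  also have "\<dots> = card (good m D)" by (simp add: card_good card_cartesian_product)
  finally show ?thesis .
qed

lemma measure_named: "measure M (\<Union>k\<in>good_level m D ` named c. lev (Suc m) k) \<le> 1 / 2 ^ K"
proof -
  have "named c \<subseteq> good m D" by (auto simp: named_def)
  then have "measure M (\<Union>k\<in>good_level m D ` named c. lev (Suc m) k) = real (card (named c)) * wid (Suc m) / vol"
    by (rule measure_levels_image)
  also have "\<dots> \<le> 1 / 2 ^ K"
  proof -
    have "real (card (named c) * 2 ^ K) \<le> real (card (good m D))"
      using card_named by (simp only: of_nat_le_iff)
    then have "real (card (named c)) * 2 ^ K * (wid (Suc m) / vol) \<le> real (card (good m D)) * (wid (Suc m) / vol)"
      using wid_pos[of "Suc m"] vol_bounds by (intro mult_right_mono) auto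
    also have "\<dots> = measure M (good_set m D)"
      unfolding good_set_def by (subst measure_levels_image) auto
    also have "\<dots> \<le> 1" using prob_space.prob_le_1[OF prob_space_M] .
    finally show ?thesis by (simp add: field_simps)
  qed
  finally show ?thesis .
qed

text \<open>A good starting place has enough room above it: the orbit climbs a single tower through
  the whole window, and the letters seen depend on one bit word only.\<close>

lemma name_in_good_set:
  assumes x: "x \<in> good_set m D" and c: "\<And>k. k \<le> K \<Longrightarrow> symb ((T ^^ s k) x) = c k"
  shows "x \<in> (\<Union>k\<in>good_level m D ` named c. lev (Suc m) k)"
proof -
  let ?l = "2 * D"
  obtain i p V where g: "(i, p, V) \<in> good m D" "x \<in> lev (Suc m) (good_level m D (i, p, V))"
    using x by (auto simp: good_set_def)
  define I where "I = V * ?l + i"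
  have I: "I \<le> length (bs m)" "i < D" "p < hgt m" "V < 2 ^ ?l"
    using good_column[OF g(1)] g(1) by (auto simp: I_def good_def)
  have drop: "drop I (bs m) = drop i (all_words ?l ! V) @ concat (drop (Suc V) (all_words ?l))"
    unfolding bs_m I_def using I all_words(1,3)[of ?l] by (intro drop_concat_uniform) auto
  have "all_words ?l ! V \<in> set (all_words ?l)" using I all_words(3)[of ?l] by simp
  then have len: "length (all_words ?l ! V) = ?l" unfolding all_words(1) by simp
  have mono: "s k \<le> s K" if "k \<le> K" for k
  proof -
    have "s k \<le> s j" if "k \<le> j" "j \<le> K" for j
      using that
    proof (induction j rule: dec_induct)
      case (step j)
      then show ?case using gap[of j] by simp
    qed simp
    then show ?thesis using that by blast
  qed
  have "blocks (word m) 2 (drop i (all_words ?l ! V)) ! (p + s k) = c k" if k: "k \<le> K" for k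
  proof -
    have "p + s k < D * hgt m" using fit I mono[OF k] by simp
    also have "\<dots> \<le> length (drop i (all_words ?l ! V)) * hgt m"
      using I len by (intro mult_right_mono) auto
    finally have z: "p + s k < length (drop i (all_words ?l ! V)) * hgt m" .
    have "length (drop i (all_words ?l ! V)) \<le> length (drop I (bs m))" unfolding drop by simp
    then have "length (drop i (all_words ?l ! V)) * hgt m \<le> length (blocks (word m) 2 (drop I (bs m)))"
      by (simp add: length_blocks trans_le_add1 del: length_drop)
    moreover have "blocks (word m) 2 (bs m) = blocks (word m) 2 (take I (bs m)) @ blocks (word m) 2 (drop I (bs m))"
      by (metis append_take_drop_id blocks_simps(3))
    then have "hgt (Suc m) = coff m I + length (blocks (word m) 2 (drop I (bs m))) + hgt m"
      using arg_cong[OF word_Suc[of m], of length] I(1) by (simp add: coff_length_blocks)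
    ultimately have "coff m I + p + s k < hgt (Suc m)" using z by linarith
    then have "symb ((T ^^ s k) x) = word (Suc m) ! (coff m I + p + s k)"
      using g(2) by (intro symb_T_funpow) (simp_all add: good_level_def I_def)
    also have "\<dots> = blocks (word m) 2 (drop i (all_words ?l ! V)) ! (p + s k)"
      using word_Suc_nth[OF I(1) drop z] by (simp add: add.assoc)
    finally show ?thesis using c[OF k] by simp
  qed
  then have "(i, p, V) \<in> named c" using g(1) by (simp add: named_def)
  then show ?thesis using g(2) by blast
qed

end

text \<open>Only the \<open>N + 1\<close> times with index \<open>N + 2 * k\<close> are used; the
  other members of the join can only make its atoms smaller. The 1/6 is the mass of the good
  set.\<close>

lemma part_entropy_window:
  fixes t :: "nat \<Rightarrow> nat"
  assumes gap: "\<And>k. k < N \<Longrightarrow> t (N + 2 * k) + hgt m + 1 \<le> t (N + 2 * Suc k)"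
    and N: "1 \<le> N" and fit: "t (3 * N) + hgt m \<le> D * hgt m"
  shows "(1 / 6 - sqrt (1 / 2 ^ N)) * (real N * ln 2 / 2) \<le>
    part_entropy M (common_refinement ((\<lambda>k. pullback_part M T (t k) symb_part) ` {1..3 * N}))"
proof -
  interpret prob_space M by (rule prob_space_M)
  let ?J = "common_refinement ((\<lambda>k. pullback_part M T (t k) symb_part) ` {1..3 * N})"
  \<comment> \<open>Times are counted from \<open>t N\<close>. The shift is absorbed by invariance
    of the measure, since \<open>G\<close> below asks for a good place at time
    \<open>t N\<close>.\<close>
  define s where "s k = t (N + 2 * k) - t N" for k
  have mono: "t N \<le> t (N + 2 * k)" if "k \<le> N" for k
    using that
  proof (induction k)
    case (Suc k)
    then show ?case using gap[of k] by simp
  qed simp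
  have gap': "s k + hgt m + 1 \<le> s (Suc k)" if "k < N" for k
    using gap[OF that] mono[of k] that by (simp add: s_def)
  have fit': "s N + hgt m \<le> D * hgt m" using fit by (simp add: s_def)
  have J: "finite_mpart M ?J"
    using N by (intro finite_mpart_common_refinement) (auto intro: finite_mpart_pullback)
  define G where "G = (T ^^ t N) -` good_set m D"
  have good: "good_set m D \<in> sets borel" unfolding good_set_def good_def by measurable
  then have G: "G \<in> events" unfolding G_def using measurable_sets[OF T_funpow_measurable, of _ "t N"] by simp
  have pG: "prob G = measure M (good_set m D)" unfolding G_def using good by (rule measure_T_funpow_vimage)
  have small: "prob (A \<inter> G) \<le> 1 / 2 ^ N" if A: "A \<in> ?J" for A
  proof -
    have "\<exists>c. \<forall>x\<in>A. symb ((T ^^ t (N + 2 * k)) x) = c" if k: "k \<le> N" for k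
    proof -
      have "pullback_part M T (t (N + 2 * k)) symb_part \<in> (\<lambda>k. pullback_part M T (t k) symb_part) ` {1..3 * N}"
        using k N by (intro imageI) auto
      from common_refinement_exists[OF A this] obtain R
        where "R \<in> pullback_part M T (t (N + 2 * k)) symb_part" "A \<subseteq> R" by blast
      then obtain i where "A \<subseteq> (T ^^ t (N + 2 * k)) -` (symb -` {i})"
        by (auto simp: pullback_part_def symb_part_def)
      then show ?thesis by (intro exI[of _ i]) auto
    qed
    then obtain c where c: "\<And>k x. k \<le> N \<Longrightarrow> x \<in> A \<Longrightarrow> symb ((T ^^ t (N + 2 * k)) x) = c k" by metis
    define S where "S = (\<Union>k\<in>good_level m D ` named s N c. lev (Suc m) k)"
    have "finite (good m D)" by (simp add: good_def)
    then have "finite (named s N c)" by (rule finite_subset[rotated]) (auto simp: named_def[OF gap' fit'])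
    then have S: "S \<in> sets borel" unfolding S_def by measurable
    have "A \<inter> G \<subseteq> (T ^^ t N) -` S"
    proof
      fix x assume x: "x \<in> A \<inter> G"
      have "symb ((T ^^ s k) ((T ^^ t N) x)) = c k" if "k \<le> N" for k
      proof -
        have "T ^^ t (N + 2 * k) = T ^^ s k \<circ> T ^^ t N"
          using mono[OF that] by (simp add: s_def flip: funpow_add)
        then show ?thesis using c[OF that, of x] x by simp
      qed
      then have "(T ^^ t N) x \<in> S"
        unfolding S_def using x by (intro name_in_good_set[OF gap' fit']) (auto simp: G_def)
      then show "x \<in> (T ^^ t N) -` S" by simp
    qed
    then have "prob (A \<inter> G) \<le> prob ((T ^^ t N) -` S)"
      using measurable_sets[OF T_funpow_measurable S, of "t N"] by (intro finite_measure_mono) auto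
    also have "\<dots> = prob S" using S by (rule measure_T_funpow_vimage)
    also have "\<dots> \<le> 1 / 2 ^ N" unfolding S_def by (rule measure_named[OF gap' fit'])
    finally show ?thesis .
  qed
  have "(1 / 6 - sqrt (1 / 2 ^ N)) * (real N * ln 2 / 2) \<le> (prob G - sqrt (1 / 2 ^ N)) * (real N * ln 2 / 2)"
    using measure_good_set pG by (intro mult_right_mono) auto
  also have "\<dots> \<le> part_entropy M ?J"
  proof -
    have eq: "real N * ln 2 / 2 = ln (1 / (1 / 2 ^ N)) / 2" by (simp add: ln_realpow)
    show ?thesis unfolding eq
      using J G small by (intro part_entropy_ge) (auto simp: finite_mpart_def)
  qed
  finally show ?thesis .
qed

end

end

section \<open>The two sequences\<close>

lemma limsup_ge_frequently:
  fixes f :: "nat \<Rightarrow> ereal"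
  assumes "\<And>n0. \<exists>n\<ge>n0. c \<le> f n"
  shows "c \<le> limsup f"
  unfolding limsup_INF_SUP
proof (rule INF_greatest)
  fix n0
  obtain n where "n0 \<le> n" "c \<le> f n" using assms by blast
  then show "c \<le> (SUP n\<in>{n0..}. f n)" by (intro SUP_upper2[of n]) auto
qed

text \<open>The threshold 8 makes the error at most 1/16, small enough to keep half of the good mass
  1/6.\<close>

lemma sqrt_half_power_le: "8 \<le> N \<Longrightarrow> sqrt (1 / 2 ^ N) \<le> 1 / 16"
proof -
  assume "8 \<le> N"
  then have "(2::real) ^ 8 \<le> 2 ^ N" by (intro power_increasing) auto
  then have "1 / 2 ^ N \<le> (1 / 16 :: real)\<^sup>2" by (simp add: field_simps)
  then show ?thesis using real_sqrt_le_mono[of "1 / 2 ^ N" "(1 / 16)\<^sup>2"] by (simp only: real_sqrt_abs) simp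
qed

text \<open>By \<open>2 \<le> exp 1\<close> and \<open>1 + 2 * D \<le> exp (2 * D)\<close>, the
  number of words and the number of bits per word cost \<open>2 * D\<close> each.\<close>

lemma ln_column_count: "ln (real (2 ^ (2 * D) * (2 * D) + 1)) \<le> 4 * real D"
proof -
  have "real (2 ^ (2 * D) * (2 * D) + 1) = 2 ^ (2 * D) * (2 * real D) + 1" by simp
  also have "\<dots> \<le> 2 ^ (2 * D) * (2 * real D) + 2 ^ (2 * D)" by simp
  also have "\<dots> = 2 ^ (2 * D) * (1 + 2 * real D)" by (simp add: algebra_simps)
  also have "\<dots> \<le> exp 1 ^ (2 * D) * exp (2 * real D)"
    using exp_ge_add_one_self[of 1] exp_ge_add_one_self[of "2 * real D"]
    by (intro mult_mono power_mono) auto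
  also have "\<dots> = exp (4 * real D)" by (simp add: exp_of_nat_mult[symmetric] exp_add[symmetric])
  finally have "ln (real (2 ^ (2 * D) * (2 * D) + 1)) \<le> ln (exp (4 * real D))"
    by (intro ln_mono) (auto intro: add_pos_nonneg)
  then show ?thesis by simp
qed

lemma rank_one_system_positive_entropy:
  fixes t N :: "nat \<Rightarrow> nat"
  assumes N: "\<And>h. 2 \<le> h \<Longrightarrow> 1 \<le> N h"
    and gap: "\<And>h k. 2 \<le> h \<Longrightarrow> k < N h \<Longrightarrow> t (N h + 2 * k) + h + 1 \<le> t (N h + 2 * Suc k)"
    and lim: "filterlim N at_top at_top"
  shows "\<exists>(M :: real measure) T h. rank_one_system M T h \<and> 0 < seq_entropy M T t \<and>
    (\<forall>n\<ge>1. 2 \<le> h n \<and>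
      ln (real (h (Suc n))) \<le> 4 * real (t (3 * N (h n)) div h n + 2) + ln (real (h n) + 1))"
proof -
  \<comment> \<open>One unit makes up for rounding down in the division, the other pays for the
    additional height in the fit condition.\<close>
  define D where "D h = t (3 * N h) div h + 2" for h
  define bits where "bits h = concat (all_words (2 * D h))" for h
  have "bits h \<noteq> []" for h
  proof -
    have "0 < length (bits h)" unfolding bits_def all_words(4) by (simp add: D_def)
    then show ?thesis by simp
  qed
  then interpret cutting_stacking bits by unfold_locales
  have bs: "bs m = concat (all_words (2 * D (hgt m)))" for m by (simp add: bs_def bits_def)
  have window: "(1 / 6 - sqrt (1 / 2 ^ N (hgt m))) * (real (N (hgt m)) * ln 2 / 2) \<le>
      part_entropy M (common_refinement ((\<lambda>k. pullback_part M T (t k) symb_part) ` {1..3 * N (hgt m)}))" for m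
  proof (rule part_entropy_window[OF bs])
    show "1 \<le> D (hgt m)" by (simp add: D_def)
    show "t (N (hgt m) + 2 * k) + hgt m + 1 \<le> t (N (hgt m) + 2 * Suc k)" if "k < N (hgt m)" for k
      using hgt_gt_1 that by (rule gap)
    show "1 \<le> N (hgt m)" using hgt_gt_1 by (rule N)
    have "t (3 * N (hgt m)) \<le> Suc (t (3 * N (hgt m)) div hgt m) * hgt m"
      using dividend_less_times_div[of "hgt m" "t (3 * N (hgt m))"] hgt_gt_1[of m]
      by (simp add: algebra_simps less_imp_le)
    then show "t (3 * N (hgt m)) + hgt m \<le> D (hgt m) * hgt m" by (simp add: D_def algebra_simps)
  qed
  have "ereal (ln 2 / 72) \<le> seq_entropy_part M T t symb_part"
    unfolding seq_entropy_part_def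
  proof (rule limsup_ge_frequently)
    fix n0 :: nat
    obtain h0 where h0: "\<And>h. h0 \<le> h \<Longrightarrow> n0 + 8 \<le> N h"
      using lim unfolding filterlim_at_top eventually_at_top_linorder by blast
    \<comment> \<open>Stage \<open>h0\<close> is late enough because heights at least
      double.\<close>
    have "h0 < 2 ^ h0" by (rule less_exp)
    then have "h0 \<le> hgt h0" using hgt_power[of h0] unfolding power_Suc by linarith
    then have n: "n0 + 8 \<le> N (hgt h0)" by (rule h0)
    let ?N = "N (hgt h0)"
    let ?H = "part_entropy M (common_refinement ((\<lambda>k. pullback_part M T (t k) symb_part) ` {1..3 * ?N}))"
    have "1 / 12 \<le> 1 / 6 - sqrt (1 / 2 ^ ?N)" using sqrt_half_power_le[of ?N] n by simp
    then have "1 / 12 * (real ?N * ln 2 / 2) \<le> (1 / 6 - sqrt (1 / 2 ^ ?N)) * (real ?N * ln 2 / 2)"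
      by (intro mult_right_mono) auto
    also have "\<dots> \<le> ?H" by (rule window)
    \<comment> \<open>72 is 12 from the remaining mass, times 2 from the entropy estimate, times 3
      because the join runs up to \<open>3 * N\<close>.\<close>
    finally have "ln 2 / 72 * real (3 * ?N) \<le> ?H" by (simp add: mult.commute)
    then have "ln 2 / 72 \<le> ?H / real (3 * ?N)" using n by (subst pos_le_divide_eq) auto
    then show "\<exists>n\<ge>n0. ereal (ln 2 / 72) \<le> ereal (part_entropy M
        (common_refinement ((\<lambda>k. pullback_part M T (t k) symb_part) ` {1..n})) / real n)"
      using n by (intro exI[of _ "3 * ?N"]) simp
  qed
  also have "\<dots> \<le> seq_entropy M T t"
    unfolding seq_entropy_def using finite_mpart_symb_part by (intro SUP_upper) simp
  finally have "ereal (ln 2 / 72) \<le> seq_entropy M T t" .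
  moreover have "0 < ereal (ln 2 / 72)" by simp
  ultimately have pos: "0 < seq_entropy M T t" by (rule less_le_trans[rotated])
  have growth: "ln (real (hgt (Suc m))) \<le> 4 * real (D (hgt m)) + ln (real (hgt m) + 1)" for m
  proof -
    have c: "ncol m = 2 ^ (2 * D (hgt m)) * (2 * D (hgt m)) + 1"
      unfolding ncol_def bs all_words(4) by simp
    have "count_list (bs m) True \<le> length (bs m)" by (rule count_le_length)
    then have "hgt (Suc m) \<le> ncol m * (hgt m + 1)" by (simp add: ncol_def hgt.simps(2) bs_def)
    then have "real (hgt (Suc m)) \<le> real (ncol m) * (real (hgt m) + 1)"
      by (metis of_nat_1 of_nat_add of_nat_le_iff of_nat_mult)
    then have "ln (real (hgt (Suc m))) \<le> ln (real (ncol m) * (real (hgt m) + 1))"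
      using hgt_gt_1[of "Suc m"] by (intro ln_mono) auto
    also have "\<dots> = ln (real (ncol m)) + ln (real (hgt m) + 1)"
      by (intro ln_mult_pos) (auto simp: ncol_def)
    also have "ln (real (ncol m)) \<le> 4 * real (D (hgt m))" unfolding c by (rule ln_column_count)
    finally show ?thesis by simp
  qed
  show ?thesis
  proof (intro exI conjI allI impI)
    show "rank_one_system M T rank_one_height" by (rule rank_one_system_M)
    show "0 < seq_entropy M T t" by (rule pos)
    fix n :: nat assume "1 \<le> n"
    show "2 \<le> hgt (n - 1)" by (rule hgt_gt_1)
    have "Suc n - 1 = Suc (n - 1)" using \<open>1 \<le> n\<close> by simp
    then show "ln (real (hgt (Suc n - 1))) \<le>
        4 * real (t (3 * N (hgt (n - 1))) div hgt (n - 1) + 2) + ln (real (hgt (n - 1)) + 1)"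
      using growth[of "n - 1"] by (simp only: D_def)
  qed
qed

text \<open>Here \<open>g n\<close> bounds the gaps from below: as \<open>g\<close> is
  nondecreasing, two steps from \<open>n\<close> gain at least \<open>2 * g n\<close>. The bound
  with \<open>C\<close> says that \<open>g\<close> has not grown much by the end of the
  window.\<close>

lemma rank_one_system_floor_sequence:
  fixes g :: "nat \<Rightarrow> real" and N :: "nat \<Rightarrow> nat"
  assumes g: "\<And>n n'. 1 \<le> n \<Longrightarrow> n \<le> n' \<Longrightarrow> g n \<le> g n'"
    and N: "\<And>h. 2 \<le> h \<Longrightarrow> 1 \<le> N h" "\<And>h. 2 \<le> h \<Longrightarrow> real h \<le> g (N h)"
      "\<And>h. 2 \<le> h \<Longrightarrow> g (3 * N h) \<le> C * real h"
  shows "\<exists>(M :: real measure) T h. rank_one_system M T h \<and>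
    0 < seq_entropy M T (\<lambda>n. nat \<lfloor>real n * g n\<rfloor>) \<and>
    (\<forall>n\<ge>1. 2 \<le> h n \<and> ln (real (h (Suc n))) \<le> 4 * (3 * C * real (N (h n)) + 2) + ln (real (h n) + 1))"
proof -
  let ?t = "\<lambda>n. nat \<lfloor>real n * g n\<rfloor>"
  have gap: "?t n + h + 1 \<le> ?t (n + 2)" if "2 \<le> h" "N h \<le> n" for n h
  proof -
    have h: "real h \<le> g n" using N(2)[OF that(1)] g[of "N h" n] N(1)[OF that(1)] that(2) by linarith
    have "real n * g n + 2 * real h \<le> real n * g n + 2 * g n" using h by simp
    also have "\<dots> = real (n + 2) * g n" by (simp add: algebra_simps)
    also have "\<dots> \<le> real (n + 2) * g (n + 2)"
      using g[of n "n + 2"] N(1)[OF that(1)] that(2) by (intro mult_left_mono) auto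
    finally have le: "real n * g n + 2 * real h \<le> real (n + 2) * g (n + 2)" .
    have "0 \<le> real n * g n" using h by simp
    \<comment> \<open>A gain of the integer \<open>2 * h\<close> survives rounding, and it is at
      least \<open>h + 1\<close>. A single step is only guaranteed to gain \<open>h\<close>, hence
      every other term.\<close>
    then have "\<lfloor>real n * g n\<rfloor> + int h + 1 \<le> \<lfloor>real (n + 2) * g (n + 2)\<rfloor>" "0 \<le> \<lfloor>real n * g n\<rfloor>"
      using le that(1) by linarith+
    then show ?thesis by linarith
  qed
  then have gap: "?t (N h + 2 * k) + h + 1 \<le> ?t (N h + 2 * Suc k)" if "2 \<le> h" for h k
    using gap[of h "N h + 2 * k"] that by simp
  have lim: "filterlim N at_top at_top"
    unfolding filterlim_at_top
  proof
    fix Z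
    have "Z \<le> N h" if "nat \<lceil>g Z\<rceil> + 2 < h" for h
    proof (rule ccontr)
      assume "\<not> Z \<le> N h"
      \<comment> \<open>Since \<open>h \<le> g (N h)\<close>, a bounded \<open>N h\<close> would
        bound \<open>h\<close>.\<close>
      then have "g (N h) \<le> g Z" using that N(1)[of h] by (intro g) auto
      then show False using N(2)[of h] that by linarith
    qed
    then show "eventually (\<lambda>h. Z \<le> N h) at_top"
      unfolding eventually_at_top_dense by blast
  qed
  from rank_one_system_positive_entropy[of N ?t, OF N(1) gap lim]
  obtain M :: "real measure" and T h where *: "rank_one_system M T h" "0 < seq_entropy M T ?t"
    "\<And>n. 1 \<le> n \<Longrightarrow> 2 \<le> h n"
    "\<And>n. 1 \<le> n \<Longrightarrow> ln (real (h (Suc n))) \<le> 4 * real (?t (3 * N (h n)) div h n + 2) + ln (real (h n) + 1)"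
    by blast
  \<comment> \<open>The window lasts a time of order \<open>N * h\<close>, so dividing by the height
    leaves a multiple of \<open>N\<close>.\<close>
  have "real (?t (3 * N (h n)) div h n) \<le> 3 * C * real (N (h n))" if "1 \<le> n" for n
  proof -
    let ?h = "h n"
    have h: "2 \<le> ?h" using *(3)[OF that] .
    have "0 \<le> g (3 * N ?h)"
      using N(1,2)[OF h] g[of "N ?h" "3 * N ?h"] by linarith
    then have "0 \<le> real (3 * N ?h) * g (3 * N ?h)" by simp
    then have "real (?t (3 * N ?h)) \<le> real (3 * N ?h) * g (3 * N ?h)" by linarith
    also have "\<dots> \<le> real (3 * N ?h) * (C * real ?h)" using N(3)[OF h] by (intro mult_left_mono) auto
    finally have "real (?t (3 * N ?h)) / real ?h \<le> 3 * C * real (N ?h)"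
      using h by (simp add: divide_le_eq mult_ac)
    then show ?thesis using of_nat_div_le_of_nat[of "?t (3 * N ?h)" ?h, where ?'a = real] by linarith
  qed
  then have "ln (real (h (Suc n))) \<le> 4 * (3 * C * real (N (h n)) + 2) + ln (real (h n) + 1)" if "1 \<le> n" for n
    using *(4)[OF that] that by fastforce
  then show ?thesis using *(1,2,3) by blast
qed

text \<open>The factor 2 comes from \<open>h + 1 \<le> h * h\<close>, and \<open>1 / \<beta>\<close>
  from rewriting \<open>ln h\<close> through \<open>ln (h powr \<beta>)\<close>.\<close>

lemma ln_Suc_le_powr:
  assumes "2 \<le> h" "0 < (\<beta>::real)"
  shows "ln (real h + 1) \<le> 2 / \<beta> * real h powr \<beta>"
proof -
  have "real h + 1 \<le> real h * real h"
  proof -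
    have "real h * 2 \<le> real h * real h" using assms(1) by (intro mult_left_mono) auto
    then show ?thesis using assms(1) by linarith
  qed
  then have "ln (real h + 1) \<le> ln (real h * real h)" using assms(1) by (intro ln_mono) auto
  also have "\<dots> = 2 / \<beta> * (\<beta> * ln (real h))" using assms by (simp add: ln_mult)
  also have "\<beta> * ln (real h) = ln (real h powr \<beta>)" using assms by (simp add: ln_powr)
  also have "2 / \<beta> * ln (real h powr \<beta>) \<le> 2 / \<beta> * real h powr \<beta>"
    using assms ln_le_minus_one[of "real h powr \<beta>"] by (intro mult_left_mono) auto
  finally show ?thesis .
qed

text \<open>The normalisation is kept abstract to serve both \<open>h powr \<beta>\<close> and its
  exponential. Dominating \<open>h powr \<beta>\<close> takes care of the logarithmic term.\<close>

lemma limsup_growth_finite: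
  fixes \<phi> :: "nat \<Rightarrow> real"
  assumes h: "\<And>n. 1 \<le> n \<Longrightarrow> 2 \<le> h n"
    and growth: "\<And>n. 1 \<le> n \<Longrightarrow> ln (real (h (Suc n))) \<le> 4 * (3 * C * real (N (h n)) + 2) + ln (real (h n) + 1)"
    and N: "\<And>k. 2 \<le> k \<Longrightarrow> real (N k) \<le> 2 * \<phi> k"
    and C: "0 \<le> C" and \<beta>: "0 < \<beta>" and \<phi>: "\<And>k. 2 \<le> k \<Longrightarrow> real k powr \<beta> \<le> \<phi> k"
  shows "limsup (\<lambda>n. ereal (ln (real (h (Suc n))) / \<phi> (h n))) < \<infinity>"
proof -
  define K where "K = 4 * (6 * C + 2) + 2 / \<beta>"
  have "ln (real (h (Suc n))) / \<phi> (h n) \<le> K" if "1 \<le> n" for n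
  proof -
    let ?k = "h n"
    have k: "2 \<le> ?k" using h[OF that] .
    have "1 \<le> real ?k powr \<beta>" using k \<beta> by (intro ge_one_powr_ge_zero) auto
    then have \<phi>1: "1 \<le> \<phi> ?k" using \<phi>[OF k] by linarith
    have "3 * C * real (N ?k) \<le> 3 * C * (2 * \<phi> ?k)" using N[OF k] C by (intro mult_left_mono) auto
    moreover have "ln (real ?k + 1) \<le> 2 / \<beta> * \<phi> ?k"
      using ln_Suc_le_powr[OF k \<beta>] mult_left_mono[OF \<phi>[OF k], of "2 / \<beta>"] \<beta> by simp
    moreover have "x \<le> 4 * (e' + 2 * f) + b"
      if "e \<le> e'" "y \<le> b" "x \<le> 4 * (e + 2) + y" "1 \<le> f" for x y e e' b f :: real
      using that by (simp add: algebra_simps)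
    ultimately have "ln (real (h (Suc n))) \<le> 4 * (3 * C * (2 * \<phi> ?k) + 2 * \<phi> ?k) + 2 / \<beta> * \<phi> ?k"
      using growth[OF that] \<phi>1 by blast
    also have "\<dots> = K * \<phi> ?k" by (simp add: K_def algebra_simps)
    finally show ?thesis using \<phi>1 by (simp add: divide_le_eq)
  qed
  then have "limsup (\<lambda>n. ereal (ln (real (h (Suc n))) / \<phi> (h n))) \<le> ereal K"
    by (intro Limsup_bounded eventually_sequentiallyI[of 1]) simp
  then show ?thesis by (rule le_less_trans) simp
qed

section \<open>The choice of the window\<close>

lemma nat_ceiling_bounds: "1 \<le> x \<Longrightarrow> x \<le> real (nat \<lceil>x\<rceil>) \<and> real (nat \<lceil>x\<rceil>) \<le> 2 * x"
  by linarith

lemma power_sequence_system: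
  fixes \<alpha> \<beta> :: real
  assumes \<beta>: "0 < \<beta>" and \<alpha>: "1 + 1 / \<beta> \<le> \<alpha>"
  shows "\<exists>(M :: real measure) T h. rank_one_system M T h \<and>
    0 < seq_entropy M T (\<lambda>n. nat \<lfloor>real n powr \<alpha>\<rfloor>) \<and>
    limsup (\<lambda>n. ereal (ln (real (h (Suc n))) / real (h n) powr \<beta>)) < \<infinity>"
proof -
  have "0 < 1 / \<beta>" using \<beta> by simp
  then have \<alpha>1: "0 < \<alpha> - 1" "1 / \<beta> \<le> \<alpha> - 1" using \<alpha> by linarith+
  \<comment> \<open>What is wanted is \<open>N powr (\<alpha> - 1) \<ge> h\<close>, so
    \<open>N\<close> is about \<open>h powr \<gamma>\<close>. The hypothesis on \<alpha> becomes
    \<open>\<gamma> \<le> \<beta>\<close>.\<close>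
  define \<gamma> where "\<gamma> = 1 / (\<alpha> - 1)"
  have \<gamma>: "0 < \<gamma>" "\<gamma> \<le> \<beta>" "\<gamma> * (\<alpha> - 1) = 1"
    using \<alpha>1 \<beta> by (auto simp: \<gamma>_def field_simps)
  define N where "N h = nat \<lceil>real h powr \<gamma>\<rceil>" for h
  have N: "real h powr \<gamma> \<le> real (N h)" "real (N h) \<le> 2 * real h powr \<gamma>" "1 \<le> real h powr \<gamma>"
    if "2 \<le> h" for h
  proof -
    show "1 \<le> real h powr \<gamma>" using that \<gamma> by (intro ge_one_powr_ge_zero) auto
    then show "real h powr \<gamma> \<le> real (N h)" "real (N h) \<le> 2 * real h powr \<gamma>"
      using nat_ceiling_bounds[of "real h powr \<gamma>"] by (auto simp: N_def)
  qed
  have \<gamma>\<alpha>: "(real h powr \<gamma>) powr (\<alpha> - 1) = real h" for h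
    using \<gamma> by (simp add: powr_powr)
  have "\<exists>(M :: real measure) T h. rank_one_system M T h \<and>
    0 < seq_entropy M T (\<lambda>n. nat \<lfloor>real n * real n powr (\<alpha> - 1)\<rfloor>) \<and>
    (\<forall>n\<ge>1. 2 \<le> h n \<and> ln (real (h (Suc n))) \<le>
      4 * (3 * 6 powr (\<alpha> - 1) * real (N (h n)) + 2) + ln (real (h n) + 1))"
  proof (rule rank_one_system_floor_sequence)
    show "real n powr (\<alpha> - 1) \<le> real n' powr (\<alpha> - 1)" if "1 \<le> n" "n \<le> n'" for n n' :: nat
      using that \<alpha>1 by (intro powr_mono2) auto
    fix h :: nat assume h: "2 \<le> h"
    show "1 \<le> N h" using N(1,3)[OF h] by linarith
    have "(real h powr \<gamma>) powr (\<alpha> - 1) \<le> real (N h) powr (\<alpha> - 1)"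
      using N[OF h] \<alpha>1 by (intro powr_mono2) auto
    then show "real h \<le> real (N h) powr (\<alpha> - 1)" by (simp only: \<gamma>\<alpha>)
    \<comment> \<open>In the 6, a factor 3 is the end of the window and a factor 2 the loss in
      rounding up.\<close>
    have "real (3 * N h) powr (\<alpha> - 1) \<le> (6 * real h powr \<gamma>) powr (\<alpha> - 1)"
      using N[OF h] \<alpha>1 by (intro powr_mono2) auto
    then show "real (3 * N h) powr (\<alpha> - 1) \<le> 6 powr (\<alpha> - 1) * real h"
      by (simp add: powr_mult \<gamma>\<alpha>)
  qed
  then obtain M :: "real measure" and T h where *: "rank_one_system M T h"
    "0 < seq_entropy M T (\<lambda>n. nat \<lfloor>real n * real n powr (\<alpha> - 1)\<rfloor>)"
    "\<And>n. 1 \<le> n \<Longrightarrow> 2 \<le> h n"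
    "\<And>n. 1 \<le> n \<Longrightarrow> ln (real (h (Suc n))) \<le>
      4 * (3 * 6 powr (\<alpha> - 1) * real (N (h n)) + 2) + ln (real (h n) + 1)" by blast
  have "real n * real n powr (\<alpha> - 1) = real n powr \<alpha>" for n :: nat
    by (cases "n = 0") (simp_all add: powr_diff)
  then have "0 < seq_entropy M T (\<lambda>n. nat \<lfloor>real n powr \<alpha>\<rfloor>)" using *(2) by simp
  moreover have "limsup (\<lambda>n. ereal (ln (real (h (Suc n))) / real (h n) powr \<beta>)) < \<infinity>"
  proof (rule limsup_growth_finite[where h = h and N = N and \<beta> = \<beta> and C = "6 powr (\<alpha> - 1)" and \<phi> = "\<lambda>k. real k powr \<beta>"])
    show "real (N k) \<le> 2 * real k powr \<beta>" if "2 \<le> k" for k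
      using N(2)[OF that] powr_mono[of \<gamma> \<beta> "real k"] \<gamma>(2) that by linarith
  qed (use \<beta> *(3,4) in auto)
  ultimately show ?thesis using *(1) by blast
qed

lemma log_power_sequence_system:
  fixes \<alpha> \<beta> :: real
  assumes \<beta>: "0 < \<beta>" and \<alpha>: "1 / \<beta> \<le> \<alpha>"
  shows "\<exists>(M :: real measure) T h. rank_one_system M T h \<and>
    0 < seq_entropy M T (\<lambda>n. nat \<lfloor>real n * ln (real n) powr \<alpha>\<rfloor>) \<and>
    limsup (\<lambda>n. ereal (ln (real (h (Suc n))) / exp (real (h n) powr \<beta>))) < \<infinity>"
proof -
  have "0 < 1 / \<beta>" using \<beta> by simp
  then have \<alpha>0: "0 < \<alpha>" using \<alpha> by linarith
  \<comment> \<open>Now \<open>ln N powr \<alpha> \<ge> h\<close> is wanted, hence \<open>N\<close>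
    about \<open>exp (h powr \<gamma>)\<close>; again the hypothesis on \<alpha> becomes
    \<open>\<gamma> \<le> \<beta>\<close>.\<close>
  define \<gamma> where "\<gamma> = 1 / \<alpha>"
  have \<gamma>: "0 < \<gamma>" "\<gamma> \<le> \<beta>" "\<gamma> * \<alpha> = 1"
    using \<alpha>0 \<alpha> \<beta> by (auto simp: \<gamma>_def field_simps)
  define N where "N h = nat \<lceil>exp (real h powr \<gamma>)\<rceil>" for h
  have N: "exp (real h powr \<gamma>) \<le> real (N h)" "real (N h) \<le> 2 * exp (real h powr \<gamma>)" "1 \<le> real h powr \<gamma>"
    if "2 \<le> h" for h
  proof -
    show "1 \<le> real h powr \<gamma>" using that \<gamma> by (intro ge_one_powr_ge_zero) auto
    show "exp (real h powr \<gamma>) \<le> real (N h)" "real (N h) \<le> 2 * exp (real h powr \<gamma>)"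
      using nat_ceiling_bounds[of "exp (real h powr \<gamma>)"] by (auto simp: N_def)
  qed
  have \<gamma>\<alpha>: "(real h powr \<gamma>) powr \<alpha> = real h" for h
    using \<gamma> by (simp add: powr_powr)
  have "\<exists>(M :: real measure) T h. rank_one_system M T h \<and>
    0 < seq_entropy M T (\<lambda>n. nat \<lfloor>real n * ln (real n) powr \<alpha>\<rfloor>) \<and>
    (\<forall>n\<ge>1. 2 \<le> h n \<and> ln (real (h (Suc n))) \<le>
      4 * (3 * 6 powr \<alpha> * real (N (h n)) + 2) + ln (real (h n) + 1))"
  proof (rule rank_one_system_floor_sequence)
    show "ln (real n) powr \<alpha> \<le> ln (real n') powr \<alpha>" if "1 \<le> n" "n \<le> n'" for n n' :: nat
      using that \<alpha>0 by (intro powr_mono2) auto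
    fix h :: nat assume h: "2 \<le> h"
    have pos: "0 < real (N h)" using N(1)[OF h] exp_gt_zero[of "real h powr \<gamma>"] by linarith
    then show "1 \<le> N h" by linarith
    have "real h powr \<gamma> = ln (exp (real h powr \<gamma>))" by simp
    also have "\<dots> \<le> ln (real (N h))" using N(1)[OF h] by (intro ln_mono) auto
    finally have "(real h powr \<gamma>) powr \<alpha> \<le> ln (real (N h)) powr \<alpha>"
      using \<alpha>0 by (intro powr_mono2) auto
    then show "real h \<le> ln (real (N h)) powr \<alpha>" by (simp only: \<gamma>\<alpha>)
    have "ln (real (3 * N h)) \<le> ln (6 * exp (real h powr \<gamma>))"
      using N(2)[OF h] pos by (intro ln_mono) auto
    also have "\<dots> = ln 6 + real h powr \<gamma>" by (simp add: ln_mult)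
    \<comment> \<open>Here \<open>ln 6 \<le> 5\<close>, and \<open>h powr \<gamma> \<ge> 1\<close>
      turns this additive loss into a multiple.\<close>
    also have "\<dots> \<le> 6 * real h powr \<gamma>" using ln_le_minus_one[of "6::real"] N(3)[OF h] by simp
    finally have "ln (real (3 * N h)) powr \<alpha> \<le> (6 * real h powr \<gamma>) powr \<alpha>"
      using \<alpha>0 pos by (intro powr_mono2) auto
    then show "ln (real (3 * N h)) powr \<alpha> \<le> 6 powr \<alpha> * real h"
      by (simp add: powr_mult \<gamma>\<alpha>)
  qed
  then obtain M :: "real measure" and T h where *: "rank_one_system M T h"
    "0 < seq_entropy M T (\<lambda>n. nat \<lfloor>real n * ln (real n) powr \<alpha>\<rfloor>)"
    "\<And>n. 1 \<le> n \<Longrightarrow> 2 \<le> h n"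
    "\<And>n. 1 \<le> n \<Longrightarrow> ln (real (h (Suc n))) \<le>
      4 * (3 * 6 powr \<alpha> * real (N (h n)) + 2) + ln (real (h n) + 1)" by blast
  have "limsup (\<lambda>n. ereal (ln (real (h (Suc n))) / exp (real (h n) powr \<beta>))) < \<infinity>"
  proof (rule limsup_growth_finite[where h = h and N = N and \<beta> = \<beta> and C = "6 powr \<alpha>" and \<phi> = "\<lambda>k. exp (real k powr \<beta>)"])
    show "real (N k) \<le> 2 * exp (real k powr \<beta>)" if "2 \<le> k" for k
    proof -
      have "real k powr \<gamma> \<le> real k powr \<beta>" using \<gamma> that by (intro powr_mono) auto
      then have "exp (real k powr \<gamma>) \<le> exp (real k powr \<beta>)" by simp
      then show ?thesis using N(2)[OF that] by linarith
    qed
    show "real k powr \<beta> \<le> exp (real k powr \<beta>)" for k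
      using exp_ge_add_one_self[of "real k powr \<beta>"] by linarith
  qed (use \<beta> *(3,4) in auto)
  then show ?thesis using *(1,2) by blast
qed

theorem theorem1p8:
  shows "(\<forall>\<alpha> \<beta> :: real. \<alpha> > 0 \<and> \<beta> > 0 \<and> \<alpha> \<ge> 1 + 1 / \<beta> \<longrightarrow>
      (\<exists>(M :: real measure) T h. rank_one_system M T h \<and>
         seq_entropy M T (\<lambda>n. nat \<lfloor>real n powr \<alpha>\<rfloor>) > 0 \<and>
         limsup (\<lambda>n. ereal (ln (real (h (Suc n))) / real (h n) powr \<beta>)) < \<infinity>))
    \<and> (\<forall>\<alpha> \<beta> :: real. \<alpha> > 0 \<and> \<beta> > 0 \<and> \<alpha> \<ge> 1 / \<beta> \<longrightarrow>
      (\<exists>(M :: real measure) T h. rank_one_system M T h \<and>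
         seq_entropy M T (\<lambda>n. nat \<lfloor>real n * ln (real n) powr \<alpha>\<rfloor>) > 0 \<and>
         limsup (\<lambda>n. ereal (ln (real (h (Suc n))) / exp (real (h n) powr \<beta>))) < \<infinity>))"
  using power_sequence_system log_power_sequence_system by blast

end
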